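(* Given integers $w\ge 1$ and $2\le d\le 2w$, we have \[ \frac{X[n,d,w]}{V_n}\to x_{d,w}\quad\text{almost surely as } n\to\infty, \] where the limits $x_{d,w}$ are positive numbers satisfying the recurrence \[ x_{2,1}=\frac{1}{\alpha+\beta+1},\qquad x_{d,w}=\frac{1}{\alpha w+\beta+1}\bigl[\alpha_1(w-1)x_{d,w-1}+\alpha_2(w-1)x_{d-1,w-1}+\beta x_{d-2,w-1}\bigr]\quad (w\ge 2), \] with $x_{d,w}=0$ whenever $2\le d\le 2w$ does not hold.
   Context: Random graph model with parameters $0<p\le 1$, $q,r\in[0,1]$. Vertices, edges and triangles carry nonnegative integer weights. At time $0$ there is a single triangle on three vertices; the triangle has weight $1$ and each of its three edges has weight $1$ (all other pairs/triplets have weight $0$). At each step $n=1,2,\dots$ three vertices interact, chosen as follows, all the choices of rule being independent of the past. With probability $p$ a new vertex is added and it interacts with two distinct old vertices: with (conditional) probability $r$ these are the endpoints of an edge chosen with probability proportional to its weight, and with probability $1-r$ they are two distinct old vertices chosen uniformly at random. With probability $1-p$ three old vertices interact: with (conditional) probability $q$ a triangle is chosen with probability proportional to its weight, and with probability $1-q$ three distinct old vertices are chosen uniformly at random. After the three interacting vertices are selected, any missing edges among them are drawn, and the weight of the triangle they form and of each of its three edges is increased by $1$. The weight of a vertex is the sum of the weights of the triangles containing it; its degree is its number of neighbours. $V_n$ is the number of vertices after $n$ steps ($V_0=3$), and $X[n,d,w]$ is the number of vertices having degree $d$ and weight $w$ after $n$ steps. Constants: $\alpha_1=(1-p)q$,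 $\alpha_2=\frac{2pr}{3}$, $\alpha=\alpha_1+\alpha_2$, $\beta=2(1-r)+\frac{3(1-p)(1-q)}{p}$.
   Formalization: Positivity of the limits x_{d,w} is asserted only when α₁, α₂ and β are all positive (otherwise only x_{d,w} ≥ 0), since e.g. x_{2,2}=0 if α₁=0, x_{3,2}=0 if α₂=0 and x_{4,2}=0 if β=0. *)

theory Defs
  imports "HOL-Probability.Probability" "HOL-Library.Monad_Syntax"
begin

text \<open>
  The vertices are numbered in order of birth, so that the vertex set is \<open>{..<nverts G}\<close>.  Edges and
  triangles are two- and three-element vertex sets.  Their nonnegative integer weights are the
  multiplicities in a multiset, hence \<open>pmf_of_multiset\<close> chooses with probability proportional to the
  weight.  A pair of vertices is joined by an edge iff its weight is positive.
\<close>

datatype wgraph =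
  WGraph (nverts: nat) (edges: "nat set multiset") (triangles: "nat set multiset")

definition subsets_of_card :: "nat \<Rightarrow> nat set \<Rightarrow> nat set set" where
  "subsets_of_card k A = {B. B \<subseteq> A \<and> card B = k}"

definition initial_graph :: wgraph where
  "initial_graph = WGraph 3 (mset_set (subsets_of_card 2 {0, 1, 2})) {#{0, 1, 2}#}"

text \<open>
  Interaction of the vertices of the triple \<open>t\<close>; \<open>N\<close> is the number of vertices afterwards.
\<close>

definition interact :: "nat \<Rightarrow> nat set \<Rightarrow> wgraph \<Rightarrow> wgraph" where
  "interact N t G =
     WGraph N (edges G + mset_set (subsets_of_card 2 t)) (add_mset t (triangles G))"

definition step :: "real \<Rightarrow> real \<Rightarrow> real \<Rightarrow> wgraph \<Rightarrow> wgraph pmf" where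
  "step p q r G = do {
     new_vertex \<leftarrow> bernoulli_pmf p;
     if new_vertex then do {
       by_weight \<leftarrow> bernoulli_pmf r;
       e \<leftarrow> (if by_weight then pmf_of_multiset (edges G)
             else pmf_of_set (subsets_of_card 2 {..<nverts G}));
       return_pmf (interact (Suc (nverts G)) (insert (nverts G) e) G)
     } else do {
       by_weight \<leftarrow> bernoulli_pmf q;
       t \<leftarrow> (if by_weight then pmf_of_multiset (triangles G)
             else pmf_of_set (subsets_of_card 3 {..<nverts G}));
       return_pmf (interact (nverts G) t G)
     }
   }"

text \<open>
  \<open>S n\<close> is the weighted graph after \<open>n\<close> steps.  The last conjunct says that, conditionally on any
  history of positive probability up to time \<open>n\<close>, the next graph has distribution
  \<open>step p q r (S n)\<close>.  Since \<open>S 0\<close> is deterministic and \<open>step\<close> has finite support at each graph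
  that can be reached, only countably many histories have positive probability, and these
  conditions determine the law of the process.
\<close>

definition interaction_process ::
  "'a measure \<Rightarrow> real \<Rightarrow> real \<Rightarrow> real \<Rightarrow> (nat \<Rightarrow> 'a \<Rightarrow> wgraph) \<Rightarrow> bool" where
  "interaction_process M p q r S \<longleftrightarrow>
     (\<forall>n. S n \<in> measurable M (count_space UNIV)) \<and>
     (AE \<omega> in M. S 0 \<omega> = initial_graph) \<and>
     (\<forall>n h G. measure M {\<omega> \<in> space M. (\<forall>i\<le>n. S i \<omega> = h i) \<and> S (Suc n) \<omega> = G} =
              measure M {\<omega> \<in> space M. \<forall>i\<le>n. S i \<omega> = h i} * pmf (step p q r (h n)) G)"

definition degree :: "wgraph \<Rightarrow> nat \<Rightarrow> nat" where
  "degree G v = card {u \<in> {..<nverts G}. u \<noteq> v \<and> {u, v} \<in># edges G}"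

definition vertex_weight :: "wgraph \<Rightarrow> nat \<Rightarrow> nat" where
  "vertex_weight G v = (\<Sum>t | t \<in># triangles G \<and> v \<in> t. count (triangles G) t)"

definition num_vertices :: "wgraph \<Rightarrow> nat \<Rightarrow> nat \<Rightarrow> nat" where
  "num_vertices G d w = card {v \<in> {..<nverts G}. degree G v = d \<and> vertex_weight G v = w}"

definition alpha1 :: "real \<Rightarrow> real \<Rightarrow> real" where
  "alpha1 p q = (1 - p) * q"

definition alpha2 :: "real \<Rightarrow> real \<Rightarrow> real" where
  "alpha2 p r = 2 * p * r / 3"

definition alpha :: "real \<Rightarrow> real \<Rightarrow> real \<Rightarrow> real" where
  "alpha p q r = alpha1 p q + alpha2 p r"

definition beta :: "real \<Rightarrow> real \<Rightarrow> real \<Rightarrow> real" where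
  "beta p q r = 2 * (1 - r) + 3 * (1 - p) * (1 - q) / p"

end

theory Submission
  imports Defs "HOL-Library.Discrete_Functions"
begin

text \<open>
  Let \<open>X d w\<close> be the number of vertices of degree \<open>d\<close> and weight \<open>w\<close> after \<open>n\<close> steps, and \<open>V\<close> the
  number of vertices.  A vertex takes part in the next step with probability proportional to its
  weight when the choice is made by weight, because the edges at a vertex have total weight twice the
  weight of the vertex, and with probability \<open>2 / V\<close> or \<open>3 / V\<close> when the choice is uniform.  Taking
  part raises the weight by one; it raises the degree by \<open>0\<close> if an old triangle was chosen by weight,
  by \<open>1\<close> if an old edge was chosen by weight and joined to the new vertex, and by \<open>2\<close> if the choice was
  uniform, unless a neighbour was chosen as well.  That exception contributes only \<open>O(1 / V)\<close> to the
  expected change of \<open>X d w\<close>, since a vertex of bounded weight has bounded degree.  Hence, up to a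
  vanishing error, the expected change of \<open>X d w\<close> given the past is the probability \<open>p\<close> of a new vertex
  if \<open>d = 2\<close> and \<open>w = 1\<close>, and \<open>0\<close> otherwise, plus a linear combination of
  \<open>X d w\<close>, \<open>X d (w - 1)\<close>, \<open>X (d - 1) (w - 1)\<close> and \<open>X (d - 2) (w - 1)\<close>, with coefficients of order
  \<open>1 / n\<close> (\<open>drift_num_vertices\<close>).

  The difference between the true and the expected change is a martingale difference that is bounded
  because one step touches only three old or new vertices.  A second-moment argument shows that the
  averages of such differences tend to zero almost surely (\<open>noise_average_tendsto_0\<close>).  What remains
  holds path by path: a sequence with \<open>X (n + 1) - X n = b n - c n * X n / (n + 1) + noise\<close>, where
  \<open>b n\<close> and \<open>c n \<ge> 0\<close> converge to \<open>b\<close> and \<open>c\<close>, satisfies \<open>X n / (n + 1) \<longlonglongrightarrow> b / (1 + c)\<close>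
  (\<open>perturbed_recurrence_limit\<close>).  Applied to \<open>V\<close> this gives \<open>V / n \<longlonglongrightarrow> p\<close>; applied to \<open>X d w\<close>, by
  induction on \<open>w\<close>, it gives \<open>X d w / n \<longlonglongrightarrow> p * x d w\<close> with the recurrence of the theorem, in which the
  denominator \<open>\<alpha> w + \<beta> + 1\<close> is \<open>1 + c\<close>.
\<close>

section \<open>Markov chains with finitely many reachable states\<close>

text \<open>
  The Markov property is stated through the probabilities of individual histories, and the state
  type may be uncountable, so that arbitrary sets of histories need not be measurable.  The finite sets
  \<open>R n\<close> make up for this: up to a null set, every history of length \<open>n\<close> is one of finitely many, and
  expectations reduce to finite sums.
\<close>

locale finite_chain = prob_space M for M :: "'a measure" +
  fixes S :: "nat \<Rightarrow> 'a \<Rightarrow> 's" and K :: "'s \<Rightarrow> 's pmf" and R :: "nat \<Rightarrow> 's set"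
  assumes measurable_S [measurable]: "S n \<in> measurable M (count_space UNIV)"
    and initial: "AE \<omega> in M. S 0 \<omega> \<in> R 0"
    and finite_R: "finite (R n)"
    and step_R: "s \<in> R n \<Longrightarrow> set_pmf (K s) \<subseteq> R (Suc n)"
    and markov: "measure M {\<omega> \<in> space M. (\<forall>i\<le>n. S i \<omega> = h i) \<and> S (Suc n) \<omega> = s} =
                 measure M {\<omega> \<in> space M. \<forall>i\<le>n. S i \<omega> = h i} * pmf (K (h n)) s"
begin

lemma finite_set_pmf_K: "s \<in> R n \<Longrightarrow> finite (set_pmf (K s))"
  using step_R finite_R finite_subset by metis

text \<open>
  The events that the next state is \<open>s\<close>, for the finitely many \<open>s\<close> in the support of the kernel,
  are disjoint and their probabilities add up to that of the history.
\<close>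

lemma AE_step_given_history:
  assumes "h n \<in> R n"
  shows "AE \<omega> in M. (\<forall>i\<le>n. S i \<omega> = h i) \<longrightarrow> S (Suc n) \<omega> \<in> set_pmf (K (h n))"
proof -
  let ?A = "set_pmf (K (h n))"
  let ?H = "{\<omega> \<in> space M. \<forall>i\<le>n. S i \<omega> = h i}"
  let ?E = "\<lambda>s. {\<omega> \<in> space M. (\<forall>i\<le>n. S i \<omega> = h i) \<and> S (Suc n) \<omega> = s}"
  have fin: "finite ?A" using finite_set_pmf_K assms by blast
  have [measurable]: "?E s \<in> sets M" "?H \<in> sets M" for s by measurable
  have sets_U: "(\<Union>s\<in>?A. ?E s) \<in> sets M" using fin by (intro sets.finite_UN) auto
  have "measure M (\<Union>s\<in>?A. ?E s) = (\<Sum>s\<in>?A. measure M (?E s))"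
    by (rule finite_measure_finite_Union[OF fin]) (auto simp: disjoint_family_on_def)
  also have "\<dots> = measure M ?H * (\<Sum>s\<in>?A. pmf (K (h n)) s)"
    by (simp add: markov sum_distrib_left)
  also have "\<dots> = measure M ?H" using sum_pmf_eq_1[OF fin] by simp
  finally have "measure M (?H - (\<Union>s\<in>?A. ?E s)) = 0"
    by (subst finite_measure_Diff) (auto intro: sets_U)
  moreover have "?H - (\<Union>s\<in>?A. ?E s) \<in> sets M" by (intro sets.Diff sets_U) auto
  ultimately have "AE \<omega> in M. \<omega> \<notin> ?H - (\<Union>s\<in>?A. ?E s)"
    using prob_eq_0 by blast
  then show ?thesis by (rule AE_mp) (auto intro!: AE_I2)
qed

lemma AE_history_in_R: "AE \<omega> in M. \<forall>i\<le>n. S i \<omega> \<in> R i"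
  and AE_step: "AE \<omega> in M. S (Suc n) \<omega> \<in> set_pmf (K (S n \<omega>))"
proof -
  have next_step: "AE \<omega> in M. S (Suc n) \<omega> \<in> set_pmf (K (S n \<omega>))"
    if "AE \<omega> in M. \<forall>i\<le>n. S i \<omega> \<in> R i" for n
  proof -
    let ?P = "PiE {..n} R"
    have "AE \<omega> in M. \<forall>h\<in>?P. (\<forall>i\<le>n. S i \<omega> = h i) \<longrightarrow> S (Suc n) \<omega> \<in> set_pmf (K (h n))"
      by (rule AE_finite_allI) (auto intro!: finite_PiE finite_R AE_step_given_history)
    with that show ?thesis
    proof eventually_elim
      case (elim \<omega>)
      then have "restrict (\<lambda>i. S i \<omega>) {..n} \<in> ?P" by auto
      with elim(2) show ?case by fastforce
    qed
  qed
  show *: "AE \<omega> in M. \<forall>i\<le>n. S i \<omega> \<in> R i" for n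
  proof (induction n)
    case 0 then show ?case using initial by simp
  next
    case (Suc n)
    with next_step[OF Suc] show ?case
    proof eventually_elim
      case (elim \<omega>)
      then have "S (Suc n) \<omega> \<in> R (Suc n)" using step_R[of "S n \<omega>" n] by auto
      with elim show ?case by (auto simp: le_Suc_eq)
    qed
  qed
  show "AE \<omega> in M. S (Suc n) \<omega> \<in> set_pmf (K (S n \<omega>))" by (rule next_step[OF *])
qed

lemma AE_in_R: "AE \<omega> in M. S n \<omega> \<in> R n"
  using AE_history_in_R[of n] by eventually_elim auto

text \<open>
  The martingale difference of \<open>f\<close> along the chain.
\<close>

definition noise :: "('s \<Rightarrow> real) \<Rightarrow> nat \<Rightarrow> 'a \<Rightarrow> real" where
  "noise f n \<omega> = f (S (Suc n) \<omega>) - measure_pmf.expectation (K (S n \<omega>)) f"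

lemma measurable_noise [measurable]: "noise f n \<in> borel_measurable M"
proof -
  have [measurable]: "(\<lambda>\<omega>. g (S m \<omega>)) \<in> borel_measurable M" for m and g :: "'s \<Rightarrow> real"
    by (rule measurable_compose[OF measurable_S]) simp
  show ?thesis unfolding noise_def[abs_def]
    by measurable
qed

text \<open>
  This is the conditional centring of the noise, in the only form needed here: it is orthogonal to
  every function of the past.  Almost surely the integrand is a combination of the indicators of the
  finitely many histories up to time \<open>n + 1\<close>, and for each history up to time \<open>n\<close> the
  contributions of the possible next states cancel.
\<close>

lemma integral_history_times_noise:
  fixes \<phi> :: "(nat \<Rightarrow> 's) \<Rightarrow> real"
  assumes [measurable]: "(\<lambda>\<omega>. \<phi> (restrict (\<lambda>i. S i \<omega>) {..n})) \<in> borel_measurable M"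
  shows "(\<integral>\<omega>. \<phi> (restrict (\<lambda>i. S i \<omega>) {..n}) * noise f n \<omega> \<partial>M) = 0"
proof -
  let ?P = "PiE {..n} R" and ?T = "R (Suc n)"
  let ?E = "\<lambda>h s. {\<omega> \<in> space M. (\<forall>i\<le>n. S i \<omega> = h i) \<and> S (Suc n) \<omega> = s}"
  define g where "g h s = \<phi> h * (f s - measure_pmf.expectation (K (h n)) f)" for h s
  have finP: "finite ?P" by (auto intro!: finite_PiE finite_R)
  have sets_E [measurable]: "?E h s \<in> sets M" for h s by measurable
  have "AE \<omega> in M. \<phi> (restrict (\<lambda>i. S i \<omega>) {..n}) * noise f n \<omega> =
      (\<Sum>h\<in>?P. \<Sum>s\<in>?T. g h s * indicator (?E h s) \<omega>)"
    using AE_history_in_R[of "Suc n"] AE_space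
  proof eventually_elim
    case (elim \<omega>)
    let ?h = "restrict (\<lambda>i. S i \<omega>) {..n}"
    have hP: "?h \<in> ?P" using elim by auto
    \<comment> \<open>Only the history that was actually followed contributes to the double sum.\<close>
    have uniq: "h = ?h" if "h \<in> ?P" "\<forall>i\<le>n. S i \<omega> = h i" for h
      by (rule PiE_ext[OF that(1) hP]) (use that(2) in auto)
    have "(\<Sum>h\<in>?P. \<Sum>s\<in>?T. g h s * indicator (?E h s) \<omega>)
      = (\<Sum>h\<in>?P. if h = ?h then (\<Sum>s\<in>?T. if s = S (Suc n) \<omega> then g h s else 0) else 0)"
    proof (rule sum.cong[OF refl])
      fix h assume h: "h \<in> ?P"
      show "(\<Sum>s\<in>?T. g h s * indicator (?E h s) \<omega>) =
        (if h = ?h then (\<Sum>s\<in>?T. if s = S (Suc n) \<omega> then g h s else 0) else 0)"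
      proof (cases "h = ?h")
        case True
        have "\<omega> \<in> ?E ?h s \<longleftrightarrow> s = S (Suc n) \<omega>" for s using elim by auto
        then show ?thesis unfolding True by (auto simp: indicator_def intro!: sum.cong)
      next
        case False
        then have "\<omega> \<notin> ?E h s" for s using uniq[OF h] by blast
        then show ?thesis using False by simp
      qed
    qed
    also have "\<dots> = g ?h (S (Suc n) \<omega>)"
      using hP finP elim finite_R by (simp add: sum.delta)
    also have "\<dots> = \<phi> ?h * noise f n \<omega>" by (simp add: g_def noise_def)
    finally show ?case by simp
  qed
  then have "(\<integral>\<omega>. \<phi> (restrict (\<lambda>i. S i \<omega>) {..n}) * noise f n \<omega> \<partial>M) =
      (\<integral>\<omega>. (\<Sum>h\<in>?P. \<Sum>s\<in>?T. g h s * indicator (?E h s) \<omega>) \<partial>M)"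
    by (intro integral_cong_AE) (auto intro!: borel_measurable_sum)
  also have "\<dots> = (\<Sum>h\<in>?P. \<Sum>s\<in>?T. g h s * measure M (?E h s))"
  proof -
    have int: "integrable M (\<lambda>\<omega>. g h s * indicator (?E h s) \<omega>)" for h s
      by (intro integrable_mult_right integrable_real_indicator) (auto simp: less_top[symmetric])
    have val: "(\<integral>\<omega>. g h s * indicator (?E h s) \<omega> \<partial>M) = g h s * measure M (?E h s)" for h s
      using sets.sets_into_space[OF sets_E[of h s]] by (simp add: Int_absorb1 Int_absorb2)
    show ?thesis
      by (subst Bochner_Integration.integral_sum Bochner_Integration.integral_sum, intro Bochner_Integration.integrable_sum int)
        (intro sum.cong refl trans[OF Bochner_Integration.integral_sum] int val)
  qed
  also have "\<dots> = (\<Sum>h\<in>?P. 0)"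
  proof (rule sum.cong[OF refl])
    fix h assume h: "h \<in> ?P"
    have supp: "set_pmf (K (h n)) \<subseteq> ?T" using h step_R by auto
    have mean: "measure_pmf.expectation (K (h n)) f = (\<Sum>s\<in>?T. f s * pmf (K (h n)) s)"
      by (subst integral_measure_pmf[OF finite_R[of "Suc n"]]) (use supp in \<open>auto simp: mult.commute\<close>)
    have "(\<Sum>s\<in>?T. (f s - measure_pmf.expectation (K (h n)) f) * pmf (K (h n)) s) = 0"
      using mean sum_pmf_eq_1[OF finite_R supp]
      by (simp add: left_diff_distrib sum_subtractf flip: sum_distrib_left)
    moreover have "(\<Sum>s\<in>?T. g h s * measure M (?E h s)) =
       \<phi> h * measure M {\<omega> \<in> space M. \<forall>i\<le>n. S i \<omega> = h i} *
       (\<Sum>s\<in>?T. (f s - measure_pmf.expectation (K (h n)) f) * pmf (K (h n)) s)"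
      unfolding sum_distrib_left by (rule sum.cong) (simp_all add: g_def markov)
    ultimately show "(\<Sum>s\<in>?T. g h s * measure M (?E h s)) = 0" by simp
  qed
  finally show ?thesis by simp
qed

lemma AE_noise_bounded:
  assumes "\<And>n s s'. s \<in> R n \<Longrightarrow> s' \<in> set_pmf (K s) \<Longrightarrow> \<bar>f s' - f s\<bar> \<le> C"
  shows "AE \<omega> in M. \<bar>noise f n \<omega>\<bar> \<le> 2 * C"
  using AE_in_R[of n] AE_step[of n]
proof eventually_elim
  case (elim \<omega>)
  let ?K = "K (S n \<omega>)"
  have int: "integrable (measure_pmf ?K) g" for g :: "'s \<Rightarrow> real"
    by (rule integrable_measure_pmf_finite[OF finite_set_pmf_K[OF elim(1)]])
  have "measure_pmf.expectation ?K f \<le> f (S n \<omega>) + C"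
    using assms[OF elim(1)]
    by (intro measure_pmf.integral_le_const int) (force simp: AE_measure_pmf_iff)
  moreover have "f (S n \<omega>) - C \<le> measure_pmf.expectation ?K f"
    using assms[OF elim(1)]
    by (intro measure_pmf.integral_ge_const int) (force simp: AE_measure_pmf_iff)
  moreover have "\<bar>f (S (Suc n) \<omega>) - f (S n \<omega>)\<bar> \<le> C" using assms elim by blast
  ultimately show ?case unfolding noise_def by linarith
qed

text \<open>
  Orthogonality of the increments: the cross term in the square of \<open>W n + noise f n\<close> vanishes, so
  the second moment grows at most linearly.
\<close>

lemma noise_second_moment:
  assumes bound: "\<And>n. AE \<omega> in M. \<bar>noise f n \<omega>\<bar> \<le> C"
  shows "integrable M (\<lambda>\<omega>. (\<Sum>k<n. noise f k \<omega>)\<^sup>2)"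
    and "(\<integral>\<omega>. (\<Sum>k<n. noise f k \<omega>)\<^sup>2 \<partial>M) \<le> C\<^sup>2 * real n"
proof -
  let ?W = "\<lambda>n \<omega>. \<Sum>k<n. noise f k \<omega>"
  have W_bound: "AE \<omega> in M. \<bar>?W n \<omega>\<bar> \<le> real n * C" for n
  proof -
    have "AE \<omega> in M. \<forall>k. \<bar>noise f k \<omega>\<bar> \<le> C" using bound by (simp add: AE_all_countable)
    then show ?thesis
    proof eventually_elim
      case (elim \<omega>)
      have "\<bar>?W n \<omega>\<bar> \<le> (\<Sum>k<n. \<bar>noise f k \<omega>\<bar>)" by (rule sum_abs)
      also have "\<dots> \<le> (\<Sum>k<n. C)" using elim by (intro sum_mono) auto
      finally show ?case by simp
    qed
  qed
  have int_prod: "integrable M (\<lambda>\<omega>. u \<omega> * v \<omega>)"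
    if "AE \<omega> in M. \<bar>u \<omega>\<bar> \<le> a" "AE \<omega> in M. \<bar>v \<omega>\<bar> \<le> b"
      and [measurable]: "u \<in> borel_measurable M" "v \<in> borel_measurable M" for u v :: "'a \<Rightarrow> real" and a b
  proof (rule integrable_const_bound[where B = "a * b"])
    show "AE \<omega> in M. norm (u \<omega> * v \<omega>) \<le> a * b" using that(1,2)
      by eventually_elim (auto simp: abs_mult intro!: mult_mono)
  qed measurable
  have int_sq: "integrable M (\<lambda>\<omega>. (?W n \<omega>)\<^sup>2)" for n
    unfolding power2_eq_square by (rule int_prod[OF W_bound W_bound]) auto
  show "integrable M (\<lambda>\<omega>. (?W n \<omega>)\<^sup>2)" by (rule int_sq)
  show "(\<integral>\<omega>. (?W n \<omega>)\<^sup>2 \<partial>M) \<le> C\<^sup>2 * real n"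
  proof (induction n)
    case 0 then show ?case by simp
  next
    case (Suc n)
    let ?\<phi> = "\<lambda>h. \<Sum>k<n. f (h (Suc k)) - measure_pmf.expectation (K (h k)) f"
    have hist: "?\<phi> (restrict (\<lambda>i. S i \<omega>) {..n}) = ?W n \<omega>" for \<omega>
      by (rule sum.cong) (auto simp: noise_def)
    have cross: "(\<integral>\<omega>. ?W n \<omega> * noise f n \<omega> \<partial>M) = 0"
      using integral_history_times_noise[of ?\<phi> n f] unfolding hist by simp
    have int_cross: "integrable M (\<lambda>\<omega>. ?W n \<omega> * noise f n \<omega>)"
      by (rule int_prod[OF W_bound bound]) auto
    have int_noise: "integrable M (\<lambda>\<omega>. noise f n \<omega> * noise f n \<omega>)"
      by (rule int_prod[OF bound bound]) auto
    have "(?W (Suc n) \<omega>)\<^sup>2 = (?W n \<omega>)\<^sup>2 + (2 * (?W n \<omega> * noise f n \<omega>) + noise f n \<omega> * noise f n \<omega>)" for \<omega>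
      by (simp add: power2_eq_square algebra_simps)
    then have "(\<integral>\<omega>. (?W (Suc n) \<omega>)\<^sup>2 \<partial>M) =
        (\<integral>\<omega>. (?W n \<omega>)\<^sup>2 \<partial>M) + (\<integral>\<omega>. noise f n \<omega> * noise f n \<omega> \<partial>M)"
      using int_cross int_noise int_sq[of n] cross by simp
    moreover have "(\<integral>\<omega>. noise f n \<omega> * noise f n \<omega> \<partial>M) \<le> C\<^sup>2"
    proof (rule integral_le_const[OF int_noise])
      show "AE \<omega> in M. noise f n \<omega> * noise f n \<omega> \<le> C\<^sup>2" using bound[of n]
        by eventually_elim (metis abs_le_square_iff abs_ge_self order_trans power2_eq_square)
    qed
    ultimately show ?case using Suc by (simp add: algebra_simps)
  qed
qed

end

text \<open>
  Between \<open>k\<^sup>2\<close> and \<open>(k + 1)\<^sup>2\<close> a sequence with bounded increments moves by \<open>O(k)\<close>, which is negligible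
  against \<open>k\<^sup>2\<close>.
\<close>

lemma tendsto_along_squares:
  fixes W :: "nat \<Rightarrow> real"
  assumes squares: "(\<lambda>k. W (k\<^sup>2) / real (k\<^sup>2)) \<longlonglongrightarrow> 0"
    and incr: "\<And>n. \<bar>W (Suc n) - W n\<bar> \<le> C"
  shows "(\<lambda>n. W n / real n) \<longlonglongrightarrow> 0"
proof -
  have C: "C \<ge> 0" using incr[of 0] by linarith
  have diff: "\<bar>W (m + j) - W m\<bar> \<le> C * real j" for m j
  proof (induction j)
    case (Suc j) then show ?case using incr[of "m + j"] by (simp add: algebra_simps)
  qed simp
  let ?k = floor_sqrt
  have k_top: "filterlim ?k at_top at_top"
    unfolding filterlim_at_top
  proof
    fix Z :: nat
    show "\<forall>\<^sub>F n in at_top. Z \<le> ?k n"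
      using eventually_ge_at_top[of "Z\<^sup>2"] by eventually_elim (simp add: le_floor_sqrt_iff)
  qed
  have lim: "(\<lambda>k. \<bar>W (k\<^sup>2) / real (k\<^sup>2)\<bar> + C * (2 * real k) / real (k\<^sup>2)) \<longlonglongrightarrow> 0"
  proof -
    have "(\<lambda>k. C * (2 * real k) / real (k\<^sup>2)) = (\<lambda>k. 2 * C * inverse (real k))"
      by (auto simp: fun_eq_iff power2_eq_square field_simps)
    moreover have "(\<lambda>k. 2 * C * inverse (real k)) \<longlonglongrightarrow> 2 * C * 0"
      by (intro tendsto_mult tendsto_const lim_inverse_n)
    ultimately show ?thesis using tendsto_add[OF tendsto_rabs[OF squares]] by simp
  qed
  show ?thesis
  proof (rule Lim_null_comparison[OF _ filterlim_compose[OF lim k_top]])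
    show "\<forall>\<^sub>F n in at_top. norm (W n / real n) \<le>
        \<bar>W ((?k n)\<^sup>2) / real ((?k n)\<^sup>2)\<bar> + C * (2 * real (?k n)) / real ((?k n)\<^sup>2)"
      using eventually_gt_at_top[of 0]
    proof eventually_elim
      case (elim n)
      let ?m = "(?k n)\<^sup>2"
      have kpos: "?k n > 0" using elim by (simp add: floor_sqrt_greater_zero_iff)
      have le: "?m \<le> n" by (rule floor_sqrt_power2_le)
      have "n < (Suc (?k n))\<^sup>2" by (rule Suc_floor_sqrt_power2_gt)
      then have "n - ?m \<le> 2 * ?k n" by (simp add: power2_eq_square)
      then have gap: "real (n - ?m) \<le> 2 * real (?k n)" by linarith
      have "\<bar>W n - W ?m\<bar> \<le> C * real (n - ?m)"
        using diff[of ?m "n - ?m"] le_add_diff_inverse[OF le] by simp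
      also have "\<dots> \<le> C * (2 * real (?k n))" using gap C by (rule mult_left_mono)
      finally have "\<bar>W n - W ?m\<bar> \<le> C * (2 * real (?k n))" .
      then have num: "\<bar>W n\<bar> \<le> \<bar>W ?m\<bar> + C * (2 * real (?k n))" by linarith
      have "\<bar>W n\<bar> / real n \<le> (\<bar>W ?m\<bar> + C * (2 * real (?k n))) / real ?m"
      proof (rule frac_le[OF _ num])
        show "0 < real ?m" using kpos by simp
        show "real ?m \<le> real n" using le of_nat_le_iff by blast
      qed (use C in auto)
      then show ?case by (simp add: add_divide_distrib)
    qed
  qed
qed

context finite_chain begin

text \<open>
  A strong law of large numbers.  The second moment of the average at time \<open>k\<^sup>2\<close> is \<open>O(1 / k\<^sup>2)\<close>, which is
  summable, so the averages tend to zero along the squares.  The bound on the increments of \<open>f\<close> fills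
  the gaps.
\<close>

lemma noise_average_tendsto_0:
  assumes incr: "\<And>n s s'. s \<in> R n \<Longrightarrow> s' \<in> set_pmf (K s) \<Longrightarrow> \<bar>f s' - f s\<bar> \<le> C"
  shows "AE \<omega> in M. (\<lambda>n. (\<Sum>k<n. noise f k \<omega>) / real n) \<longlonglongrightarrow> 0"
proof -
  let ?W = "\<lambda>n \<omega>. \<Sum>k<n. noise f k \<omega>"
  define B where "B = (2 * C)\<^sup>2"
  have B0: "B \<ge> 0" by (simp add: B_def)
  note moment = noise_second_moment[OF AE_noise_bounded[OF incr], folded B_def]
  let ?Y = "\<lambda>k \<omega>. (?W (k\<^sup>2) \<omega> / real (k\<^sup>2))\<^sup>2"
  have Y: "(\<integral>\<^sup>+\<omega>. ennreal (?Y k \<omega>) \<partial>M) \<le> ennreal (B / (real k)\<^sup>2)" for k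
  proof (cases "k = 0")
    case True then show ?thesis by simp
  next
    case False
    have int: "integrable M (?Y k)" unfolding power_divide using moment(1) by simp
    have "(\<integral>\<omega>. ?Y k \<omega> \<partial>M) = (\<integral>\<omega>. (?W (k\<^sup>2) \<omega>)\<^sup>2 \<partial>M) / (real (k\<^sup>2))\<^sup>2"
      unfolding power_divide by simp
    also have "\<dots> \<le> B * real (k\<^sup>2) / (real (k\<^sup>2))\<^sup>2"
      by (intro divide_right_mono moment(2)) auto
    also have "\<dots> = B / (real k)\<^sup>2" using False by (simp add: power2_eq_square)
    finally show ?thesis using int by (subst nn_integral_eq_integral) (auto intro: ennreal_leI)
  qed
  have summ: "summable (\<lambda>k. B / (real k)\<^sup>2)"
    using summable_mult[OF inverse_power_summable[of 2, where 'a = real], of B]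
    by (simp add: divide_inverse)
  have "(\<integral>\<^sup>+\<omega>. (\<Sum>k. ennreal (?Y k \<omega>)) \<partial>M) = (\<Sum>k. \<integral>\<^sup>+\<omega>. ennreal (?Y k \<omega>) \<partial>M)"
    by (rule nn_integral_suminf) measurable
  also have "\<dots> \<le> (\<Sum>k. ennreal (B / (real k)\<^sup>2))"
    by (intro suminf_le Y) auto
  also have "\<dots> < \<infinity>" using B0 summ by (simp add: suminf_ennreal2)
  finally have "AE \<omega> in M. (\<Sum>k. ennreal (?Y k \<omega>)) \<noteq> \<infinity>"
    by (intro nn_integral_noteq_infinite) auto
  moreover have "AE \<omega> in M. \<forall>k. \<bar>noise f k \<omega>\<bar> \<le> 2 * C"
    using AE_noise_bounded[OF incr] by (simp add: AE_all_countable)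
  ultimately show ?thesis
  proof eventually_elim
    case (elim \<omega>)
    have "summable (\<lambda>k. ?Y k \<omega>)"
      using elim(1) by (intro summable_suminf_not_top) auto
    then have "(\<lambda>k. ?Y k \<omega>) \<longlonglongrightarrow> 0" by (rule summable_LIMSEQ_zero)
    then have "(\<lambda>k. sqrt (?Y k \<omega>)) \<longlonglongrightarrow> 0" using tendsto_real_sqrt by fastforce
    then have "(\<lambda>k. ?W (k\<^sup>2) \<omega> / real (k\<^sup>2)) \<longlonglongrightarrow> 0"
      by (subst tendsto_rabs_zero_iff[symmetric]) (simp del: of_nat_power)
    then show ?case
      by (rule tendsto_along_squares[where C = "2 * C"]) (use elim(2) in auto)
  qed
qed

end

section \<open>Perturbed linear recurrences\<close>

lemma cesaro_mean_tendsto_0: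
  fixes e :: "nat \<Rightarrow> real"
  assumes "e \<longlonglongrightarrow> 0"
  shows "(\<lambda>n. (\<Sum>k<n. e k) / real (Suc n)) \<longlonglongrightarrow> 0"
proof (rule LIMSEQ_I)
  fix r :: real assume r: "0 < r"
  from LIMSEQ_D[OF assms, of "r / 2"] r obtain N where N: "\<And>k. k \<ge> N \<Longrightarrow> \<bar>e k\<bar> < r / 2" by auto
  define B where "B = (\<Sum>k<N. \<bar>e k\<bar>)"
  have bound: "\<bar>\<Sum>k<n. e k\<bar> \<le> B + r / 2 * real n" for n
  proof -
    have "\<bar>\<Sum>k<n. e k\<bar> \<le> (\<Sum>k<n. \<bar>e k\<bar>)" by (rule sum_abs)
    also have "\<dots> \<le> (\<Sum>k<n. (if k < N then \<bar>e k\<bar> else 0) + r / 2)"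
      using N r by (intro sum_mono) (auto simp: not_less intro: less_imp_le)
    also have "\<dots> = (\<Sum>k\<in>{..<n} \<inter> {..<N}. \<bar>e k\<bar>) + r / 2 * real n"
      by (simp add: sum.distrib sum.If_cases lessThan_def)
    also have "(\<Sum>k\<in>{..<n} \<inter> {..<N}. \<bar>e k\<bar>) \<le> B"
      unfolding B_def by (rule sum_mono2) auto
    finally show ?thesis by simp
  qed
  show "\<exists>no. \<forall>n\<ge>no. norm ((\<Sum>k<n. e k) / real (Suc n) - 0) < r"
  proof (intro exI allI impI)
    fix n assume "nat \<lceil>2 * B / r\<rceil> \<le> n"
    then have "2 * B / r \<le> real n" by linarith
    then have "B \<le> r / 2 * real n" using r by (simp add: field_simps)
    then have "B + r / 2 * real n < r * real (Suc n)" using r by (simp add: algebra_simps)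
    with bound[of n] have "\<bar>\<Sum>k<n. e k\<bar> < r * real (Suc n)" by linarith
    then show "norm ((\<Sum>k<n. e k) / real (Suc n) - 0) < r"
      by (simp add: abs_divide divide_less_eq)
  qed
qed

text \<open>
  The noise enters only through its partial sums \<open>W n\<close>, so it is removed by passing to \<open>X - W\<close>.  If
  \<open>L = \<beta> / (1 + \<gamma>)\<close> is the candidate limit, the deviation \<open>e n = X n - W n - L * (n + 1)\<close> is multiplied
  in each step by \<open>1 - c n / (n + 1)\<close>, which eventually lies between \<open>0\<close> and \<open>1\<close>, and then changed by
  an error that tends to zero.  Hence \<open>\<bar>e n\<bar>\<close> is at most a constant plus the sum of the absolute
  errors, which is \<open>o(n)\<close>.
\<close>

lemma perturbed_recurrence_limit:
  fixes X b c D :: "nat \<Rightarrow> real"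
  assumes rec: "\<And>n. X (Suc n) = X n - c n * X n / real (Suc n) + b n + D n"
    and b: "b \<longlonglongrightarrow> \<beta>" and c: "c \<longlonglongrightarrow> \<gamma>" and c0: "\<And>n. c n \<ge> 0"
    and noise: "(\<lambda>n. (\<Sum>k<n. D k) / real n) \<longlonglongrightarrow> 0"
  shows "(\<lambda>n. X n / real (Suc n)) \<longlonglongrightarrow> \<beta> / (1 + \<gamma>)"
proof -
  have \<gamma>0: "\<gamma> \<ge> 0" using c c0 by (intro LIMSEQ_le_const) auto
  define W where "W n = (\<Sum>k<n. D k)" for n
  define L where "L = \<beta> / (1 + \<gamma>)"
  define e where "e n = (X n - W n) - L * real (Suc n)" for n
  define err where "err n = b n - c n * (W n / real (Suc n)) - (1 + c n) * L" for n
  have W0: "(\<lambda>n. W n / real (Suc n)) \<longlonglongrightarrow> 0"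
  proof (rule Lim_null_comparison[OF _ tendsto_rabs_zero[OF noise]])
    show "\<forall>\<^sub>F n in sequentially. norm (W n / real (Suc n)) \<le> \<bar>(\<Sum>k<n. D k) / real n\<bar>"
      using eventually_gt_at_top[of 0]
      by eventually_elim (auto simp: W_def abs_divide intro!: frac_le)
  qed
  have err0: "err \<longlonglongrightarrow> 0"
  proof -
    have "err \<longlonglongrightarrow> \<beta> - \<gamma> * 0 - (1 + \<gamma>) * L"
      unfolding err_def[abs_def] by (intro tendsto_intros b c W0)
    then show ?thesis using \<gamma>0 by (simp add: L_def)
  qed
  have e_rec: "e (Suc n) = (1 - c n / real (Suc n)) * e n + err n" for n
  proof -
    have "e (Suc n) = X n - c n * X n / real (Suc n) + b n - W n - L * real (Suc n) - L"
      by (simp add: e_def rec W_def algebra_simps)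
    also have "\<dots> = (1 - c n / real (Suc n)) * e n + err n"
      by (simp add: e_def err_def divide_simps) (simp add: algebra_simps)
    finally show ?thesis .
  qed
  have "\<forall>\<^sub>F n in sequentially. c n < \<gamma> + 1" using c by (rule order_tendstoD) simp
  then have "\<forall>\<^sub>F n in sequentially. c n \<le> real (Suc n)"
    using eventually_ge_at_top[of "nat \<lceil>\<gamma> + 1\<rceil>"] by eventually_elim linarith
  then obtain N where N: "\<And>n. n \<ge> N \<Longrightarrow> c n \<le> real (Suc n)"
    by (auto simp: eventually_sequentially)
  have e_le: "\<bar>e (N + n)\<bar> \<le> \<bar>e N\<bar> + (\<Sum>k<N + n. \<bar>err k\<bar>)" for n
  proof (induction n)
    case 0 then show ?case by (simp add: sum_nonneg)
  next
    case (Suc n)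
    let ?m = "N + n"
    have "0 \<le> 1 - c ?m / real (Suc ?m)" "1 - c ?m / real (Suc ?m) \<le> 1"
      using N[of ?m] c0[of ?m] by (auto simp: divide_le_eq)
    then have "\<bar>(1 - c ?m / real (Suc ?m)) * e ?m\<bar> \<le> \<bar>e ?m\<bar>"
      by (simp add: abs_mult mult_left_le_one_le)
    then have "\<bar>e (Suc ?m)\<bar> \<le> \<bar>e ?m\<bar> + \<bar>err ?m\<bar>" unfolding e_rec by linarith
    with Suc show ?case by simp
  qed
  have bound0: "(\<lambda>n. \<bar>e N\<bar> / real (Suc n) + (\<Sum>k<n. \<bar>err k\<bar>) / real (Suc n)) \<longlonglongrightarrow> 0"
    using tendsto_add[OF tendsto_mult_right_zero[OF LIMSEQ_inverse_real_of_nat, of "\<bar>e N\<bar>"]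
        cesaro_mean_tendsto_0[OF tendsto_rabs_zero[OF err0]]]
    by (simp add: divide_inverse)
  have "(\<lambda>n. e n / real (Suc n)) \<longlonglongrightarrow> 0"
  proof (rule Lim_null_comparison[OF _ bound0])
    show "\<forall>\<^sub>F n in sequentially. norm (e n / real (Suc n)) \<le>
        \<bar>e N\<bar> / real (Suc n) + (\<Sum>k<n. \<bar>err k\<bar>) / real (Suc n)"
      using eventually_ge_at_top[of N]
    proof eventually_elim
      case (elim n)
      then show ?case using e_le[of "n - N"]
        by (simp add: abs_divide divide_right_mono flip: add_divide_distrib)
    qed
  qed
  then have "(\<lambda>n. e n / real (Suc n) + W n / real (Suc n) + L) \<longlonglongrightarrow> 0 + 0 + L"
    by (intro tendsto_intros W0)
  moreover have "e n / real (Suc n) + W n / real (Suc n) + L = X n / real (Suc n)" for n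
    by (simp add: e_def divide_simps)
  ultimately show ?thesis by (simp add: L_def)
qed

section \<open>Inclusion probabilities of random subsets\<close>

lemma finite_subsets_of_card [simp]: "finite A \<Longrightarrow> finite (subsets_of_card k A)"
  unfolding subsets_of_card_def by simp

lemma card_subsets_of_card: "finite A \<Longrightarrow> card (subsets_of_card k A) = card A choose k"
  unfolding subsets_of_card_def by (rule n_subsets)

lemma card_subsets_of_card_containing:
  assumes "finite A" "W \<subseteq> A" "card W \<le> k"
  shows "card {B \<in> subsets_of_card k A. W \<subseteq> B} = (card A - card W) choose (k - card W)"
proof -
  have finW: "finite W" using assms finite_subset by blast
  have "bij_betw (\<lambda>C. C \<union> W) (subsets_of_card (k - card W) (A - W)) {B \<in> subsets_of_card k A. W \<subseteq> B}"
  proof (rule bij_betw_byWitness[where f' = "\<lambda>B. B - W"])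
    show "(\<lambda>C. C \<union> W) ` subsets_of_card (k - card W) (A - W) \<subseteq> {B \<in> subsets_of_card k A. W \<subseteq> B}"
    proof safe
      fix C assume C: "C \<in> subsets_of_card (k - card W) (A - W)"
      then have "finite C" using assms(1) by (auto simp: subsets_of_card_def intro: finite_subset)
      then have "card (C \<union> W) = card C + card W"
        using C finW by (intro card_Un_disjoint) (auto simp: subsets_of_card_def)
      then show "C \<union> W \<in> subsets_of_card k A" using C assms by (auto simp: subsets_of_card_def)
    qed
    show "(\<lambda>B. B - W) ` {B \<in> subsets_of_card k A. W \<subseteq> B} \<subseteq> subsets_of_card (k - card W) (A - W)"
      using finW by (auto simp: subsets_of_card_def card_Diff_subset)
  next
    show "\<forall>C\<in>subsets_of_card (k - card W) (A - W). C \<union> W - W = C"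
      by (auto simp: subsets_of_card_def)
    show "\<forall>B\<in>{B \<in> subsets_of_card k A. W \<subseteq> B}. (B - W) \<union> W = B"
      by (auto simp: subsets_of_card_def)
  qed
  then show ?thesis
    using bij_betw_same_card card_subsets_of_card[of "A - W" "k - card W"] assms finW
    by (metis card_Diff_subset finite_Diff)
qed

lemma prob_pmf_of_multiset:
  assumes "A \<noteq> {#}"
  shows "measure_pmf.prob (pmf_of_multiset A) {x. P x} = real (size (filter_mset P A)) / real (size A)"
proof -
  have "measure_pmf.prob (pmf_of_multiset A) {x. P x} =
      measure_pmf.prob (pmf_of_multiset A) ({x. P x} \<inter> set_mset A)"
    using measure_Int_set_pmf[of "pmf_of_multiset A" "{x. P x}"] assms by simp
  also have "\<dots> = (\<Sum>x\<in>{x. P x} \<inter> set_mset A. real (count A x) / real (size A))"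
    using assms by (subst measure_measure_pmf_finite) auto
  also have "(\<Sum>x\<in>{x. P x} \<inter> set_mset A. real (count A x) / real (size A)) =
      real (\<Sum>x\<in>{x. P x} \<inter> set_mset A. count A x) / real (size A)"
    by (simp add: sum_divide_distrib)
  also have "(\<Sum>x\<in>{x. P x} \<inter> set_mset A. count A x) = size (filter_mset P A)"
    unfolding size_multiset_overloaded_eq by (rule sum.cong) auto
  finally show ?thesis .
qed

lemma prob_uniform_subset_contains:
  assumes "finite A" "k \<le> card A" "v \<in> A" "1 \<le> k"
  shows "measure_pmf.prob (pmf_of_set (subsets_of_card k A)) {t. v \<in> t} = real k / real (card A)"
proof -
  have pos: "card (subsets_of_card k A) > 0"
    using assms by (simp add: card_subsets_of_card zero_less_binomial_iff)
  then have ne: "subsets_of_card k A \<noteq> {}" by auto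
  have c: "card (subsets_of_card k A \<inter> {t. v \<in> t}) = (card A - 1) choose (k - 1)"
    using card_subsets_of_card_containing[of A "{v}" k] assms by (simp add: Int_def)
  have eq: "k * (card A choose k) = card A * ((card A - 1) choose (k - 1))"
    using times_binomial_minus1_eq[of k "card A"] assms by simp
  have n0: "card A > 0" using assms by auto
  have "measure_pmf.prob (pmf_of_set (subsets_of_card k A)) {t. v \<in> t} =
      real ((card A - 1) choose (k - 1)) / real (card A choose k)"
    using ne assms by (simp add: measure_pmf_of_set c card_subsets_of_card)
  also have "\<dots> = real k / real (card A)"
  proof -
    have "real k * real (card A choose k) = real (card A) * real ((card A - 1) choose (k - 1))"
      using eq by (metis of_nat_mult)
    moreover have "real (card A choose k) \<noteq> 0" "real (card A) \<noteq> 0"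
      using n0 pos assms(1) by (auto simp: card_subsets_of_card)
    ultimately show ?thesis by (subst frac_eq_eq) (simp_all add: mult.commute)
  qed
  finally show ?thesis .
qed

lemma prob_uniform_subset_contains_pair:
  assumes "finite A" "k \<le> card A" "u \<in> A" "v \<in> A" "u \<noteq> v" "2 \<le> k"
  shows "measure_pmf.prob (pmf_of_set (subsets_of_card k A)) {t. u \<in> t \<and> v \<in> t} =
    real k * real (k - 1) / (real (card A) * real (card A - 1))"
proof -
  have pos: "card (subsets_of_card k A) > 0"
    using assms by (simp add: card_subsets_of_card zero_less_binomial_iff)
  then have ne: "subsets_of_card k A \<noteq> {}" by auto
  have c: "card (subsets_of_card k A \<inter> {t. u \<in> t \<and> v \<in> t}) = (card A - 2) choose (k - 2)"
    using card_subsets_of_card_containing[of A "{u, v}" k] assms by (simp add: Int_def numeral_2_eq_2)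
  have "k * (card A choose k) = card A * ((card A - 1) choose (k - 1))"
    using times_binomial_minus1_eq[of k "card A"] assms by simp
  moreover have "(k - 1) * ((card A - 1) choose (k - 1)) = (card A - 1) * ((card A - 2) choose (k - 2))"
    using times_binomial_minus1_eq[of "k - 1" "card A - 1"] assms by (simp add: numeral_2_eq_2)
  ultimately have eq: "k * (k - 1) * (card A choose k) = card A * (card A - 1) * ((card A - 2) choose (k - 2))"
    by (metis mult.assoc mult.left_commute)
  have n0: "card A \<ge> 2" using assms by auto
  have "measure_pmf.prob (pmf_of_set (subsets_of_card k A)) {t. u \<in> t \<and> v \<in> t} =
      real ((card A - 2) choose (k - 2)) / real (card A choose k)"
    using ne assms by (simp add: measure_pmf_of_set c card_subsets_of_card)
  also have "\<dots> = real k * real (k - 1) / (real (card A) * real (card A - 1))"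
  proof -
    have "real k * real (k - 1) * real (card A choose k) =
        real (card A) * real (card A - 1) * real ((card A - 2) choose (k - 2))"
      using eq by (metis of_nat_mult)
    moreover have "real (card A choose k) \<noteq> 0" "real (card A) * real (card A - 1) \<noteq> 0"
      using n0 pos assms(1) by (auto simp: card_subsets_of_card)
    ultimately show ?thesis by (subst frac_eq_eq) (simp_all add: mult.commute)
  qed
  finally show ?thesis .
qed

lemma expected_card_Int:
  fixes T :: "'b set pmf"
  assumes "finite A"
  shows "measure_pmf.expectation T (\<lambda>t. real (card (t \<inter> A))) = (\<Sum>v\<in>A. measure_pmf.prob T {t. v \<in> t})"
proof -
  have "(\<lambda>t. real (card (t \<inter> A))) = (\<lambda>t. \<Sum>v\<in>A. indicator {t. v \<in> t} t)"
    using assms by (auto simp: fun_eq_iff indicator_def sum.If_cases Int_def conj_commute)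
  then show ?thesis by (simp add: Bochner_Integration.integral_sum measure_pmf.emeasure_eq_measure)
qed


section \<open>Weights and degrees in reachable graphs\<close>

definition neighbours :: "wgraph \<Rightarrow> nat \<Rightarrow> nat set" where
  "neighbours G v = {u \<in> {..<nverts G}. u \<noteq> v \<and> {u, v} \<in># edges G}"

lemma degree_eq: "degree G v = card (neighbours G v)"
  by (simp add: degree_def neighbours_def)

lemma finite_neighbours [simp]: "finite (neighbours G v)"
  by (simp add: neighbours_def)

lemma vertex_weight_eq: "vertex_weight G v = size (filter_mset (\<lambda>t. v \<in> t) (triangles G))"
  unfolding vertex_weight_def size_multiset_overloaded_eq by (rule sum.cong) auto

text \<open>
  The invariants of the process after \<open>n\<close> steps.  The initial triangle counts as an interaction,
  hence the successor.
\<close>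

definition valid :: "nat \<Rightarrow> wgraph \<Rightarrow> bool" where
  "valid n G \<longleftrightarrow> 3 \<le> nverts G \<and> size (triangles G) = Suc n \<and>
     (\<forall>t\<in>#triangles G. t \<subseteq> {..<nverts G} \<and> card t = 3) \<and>
     (\<forall>v<nverts G. \<exists>t\<in>#triangles G. v \<in> t) \<and>
     edges G = (\<Sum>t\<in>#triangles G. mset_set (subsets_of_card 2 t))"

lemma card_3_finite: "card t = 3 \<Longrightarrow> finite t"
  by (metis card.infinite zero_neq_numeral)

lemma edge_iff:
  assumes "valid n G"
  shows "e \<in># edges G \<longleftrightarrow> (\<exists>t\<in>#triangles G. e \<subseteq> t \<and> card e = 2)"
proof -
  have "finite t" if "t \<in># triangles G" for t using assms that card_3_finite by (auto simp: valid_def)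
  then show ?thesis using assms by (auto simp: valid_def subsets_of_card_def)
qed

lemma card_2_subset_of_edge:
  assumes "valid n G" "e \<in># edges G" shows "card e = 2" "e \<subseteq> {..<nverts G}"
proof -
  obtain t where "t \<in># triangles G" "e \<subseteq> t" "card e = 2" using assms edge_iff by blast
  then show "card e = 2" "e \<subseteq> {..<nverts G}" using assms(1) by (auto simp: valid_def)
qed

lemma filter_sum_mset: "filter_mset P (\<Sum>x\<in>#A. f x) = (\<Sum>x\<in>#A. filter_mset P (f x))"
  by (induction A) auto

lemma size_edges:
  assumes "valid n G" shows "size (edges G) = 3 * Suc n"
proof -
  have "size (edges G) = (\<Sum>t\<in>#triangles G. size (mset_set (subsets_of_card 2 t)))"
    using assms by (simp add: valid_def image_mset.compositionality comp_def)
  also have "\<dots> = (\<Sum>t\<in>#triangles G. 3)"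
  proof (rule arg_cong[where f = sum_mset], rule image_mset_cong)
    fix t assume "t \<in># triangles G"
    then have "card t = 3" using assms by (auto simp: valid_def)
    then show "size (mset_set (subsets_of_card 2 t)) = 3"
      using card_3_finite[of t] by (simp add: card_subsets_of_card choose_two)
  qed
  finally show ?thesis using assms by (simp add: valid_def)
qed

text \<open>
  Every triangle at \<open>v\<close> contributes two edges at \<open>v\<close>.  This is where the factor \<open>2\<close> in
  \<open>alpha2\<close> comes from; the \<open>3\<close> comes from \<open>size_edges\<close>.
\<close>

lemma edge_weight_at_vertex:
  assumes "valid n G"
  shows "size (filter_mset (\<lambda>e. v \<in> e) (edges G)) = 2 * vertex_weight G v"
proof -
  have "size (filter_mset (\<lambda>e. v \<in> e) (edges G)) =
      (\<Sum>t\<in>#triangles G. size (filter_mset (\<lambda>e. v \<in> e) (mset_set (subsets_of_card 2 t))))"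
    using assms by (simp add: valid_def filter_sum_mset image_mset.compositionality comp_def)
  also have "\<dots> = (\<Sum>t\<in>#triangles G. if v \<in> t then 2 else 0)"
  proof (rule arg_cong[where f = sum_mset], rule image_mset_cong)
    fix t assume "t \<in># triangles G"
    then have c: "card t = 3" using assms by (auto simp: valid_def)
    then have fin: "finite t" by (rule card_3_finite)
    show "size (filter_mset (\<lambda>e. v \<in> e) (mset_set (subsets_of_card 2 t))) = (if v \<in> t then 2 else 0)"
    proof (cases "v \<in> t")
      case True
      then show ?thesis using fin c card_subsets_of_card_containing[of t "{v}" 2] by simp
    next
      case False
      then have "{e \<in> subsets_of_card 2 t. v \<in> e} = {}" by (auto simp: subsets_of_card_def)
      then show ?thesis using fin False by simp
    qed
  qed
  also have "\<dots> = 2 * vertex_weight G v"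
  proof -
    have "(\<Sum>t\<in>#A. if v \<in> t then 2 else 0) = 2 * size (filter_mset (\<lambda>t. v \<in> t) A)" for A
      by (induction A) auto
    then show ?thesis by (simp add: vertex_weight_eq)
  qed
  finally show ?thesis .
qed

text \<open>
  Distinct neighbours of \<open>v\<close> belong to distinct edges at \<open>v\<close>, each of weight at least one.
\<close>

lemma degree_le_twice_weight:
  assumes "valid n G" shows "degree G v \<le> 2 * vertex_weight G v"
proof -
  let ?E = "filter_mset (\<lambda>e. v \<in> e) (edges G)"
  have "card (neighbours G v) = card ((\<lambda>u. {u, v}) ` neighbours G v)"
    by (rule card_image[symmetric]) (auto simp: inj_on_def neighbours_def doubleton_eq_iff)
  also have "\<dots> \<le> card (set_mset ?E)"
    by (rule card_mono) (auto simp: neighbours_def)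
  also have "\<dots> \<le> size ?E"
  proof -
    have "card (set_mset ?E) = (\<Sum>e\<in>set_mset ?E. 1)" by simp
    also have "\<dots> \<le> (\<Sum>e\<in>set_mset ?E. count ?E e)" by (rule sum_mono) auto
    finally show ?thesis by (simp add: size_multiset_overloaded_eq)
  qed
  finally show ?thesis by (simp add: degree_eq edge_weight_at_vertex[OF assms])
qed

lemma triangle_minus_vertex_subset_neighbours:
  assumes "valid n G" "t \<in># triangles G" "v \<in> t"
  shows "t - {v} \<subseteq> neighbours G v"
  using assms edge_iff[OF assms(1)] by (fastforce simp: neighbours_def valid_def)

lemma weight_pos:
  assumes "valid n G" "v < nverts G" shows "vertex_weight G v \<ge> 1"
proof -
  obtain t where "t \<in># filter_mset (\<lambda>t. v \<in> t) (triangles G)" using assms by (auto simp: valid_def)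
  then have "filter_mset (\<lambda>t. v \<in> t) (triangles G) \<noteq> {#}" by force
  then have "0 < size (filter_mset (\<lambda>t. v \<in> t) (triangles G))"
    using nonempty_has_size by blast
  then show ?thesis by (simp add: vertex_weight_eq)
qed

lemma degree_ge_2:
  assumes "valid n G" "v < nverts G" shows "degree G v \<ge> 2"
proof -
  obtain t where t: "t \<in># triangles G" "v \<in> t" using assms by (auto simp: valid_def)
  then have "card (t - {v}) = 2" using assms(1) by (auto simp: valid_def)
  then show ?thesis
    using card_mono[OF _ triangle_minus_vertex_subset_neighbours[OF assms(1) t]] by (simp add: degree_eq)
qed


section \<open>A single interaction\<close>

text \<open>
  \<open>t\<close> may interact in \<open>G\<close>, with \<open>N\<close> vertices afterwards; a new vertex always takes part.
\<close>

definition admissible :: "wgraph \<Rightarrow> nat \<Rightarrow> nat set \<Rightarrow> bool" where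
  "admissible G N t \<longleftrightarrow> card t = 3 \<and> t \<subseteq> {..<N} \<and>
     (N = nverts G \<or> N = Suc (nverts G) \<and> nverts G \<in> t)"

lemma valid_interact:
  assumes "valid n G" "admissible G N t"
  shows "valid (Suc n) (interact N t G)"
proof -
  have N: "nverts G \<le> N" using assms by (auto simp: admissible_def)
  have "\<exists>s\<in>#add_mset t (triangles G). v \<in> s" if "v < N" for v
  proof (cases "v < nverts G")
    case True then show ?thesis using assms(1) by (auto simp: valid_def)
  next
    case False
    then have "v \<in> t" using that assms(2) by (auto simp: admissible_def less_Suc_eq)
    then show ?thesis by simp
  qed
  moreover have "s \<subseteq> {..<N} \<and> card s = 3" if "s \<in># add_mset t (triangles G)" for s
  proof (cases "s = t")
    case True then show ?thesis using assms(2) by (auto simp: admissible_def)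
  next
    case False
    then have "s \<subseteq> {..<nverts G}" "card s = 3" using that assms(1) by (auto simp: valid_def)
    then show ?thesis using N by auto
  qed
  ultimately show ?thesis
    using assms(1) N by (simp add: valid_def interact_def add.commute)
qed

lemma vertex_weight_interact:
  "vertex_weight (interact N t G) v = vertex_weight G v + (if v \<in> t then 1 else 0)"
  by (simp add: vertex_weight_eq interact_def)

lemma neighbours_interact:
  assumes "valid n G" "admissible G N t"
  shows "neighbours (interact N t G) v = neighbours G v \<union> (if v \<in> t then t - {v} else {})"
proof -
  have fin: "finite t" using assms card_3_finite by (auto simp: admissible_def)
  have N: "nverts G \<le> N" "t \<subseteq> {..<N}" using assms by (auto simp: admissible_def)
  have new: "{u, v} \<in> subsets_of_card 2 t \<longleftrightarrow> u \<in> t \<and> v \<in> t \<and> u \<noteq> v" for u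
    by (auto simp: subsets_of_card_def card_insert_if)
  have old: "u < nverts G" "u < N" if "{u, v} \<in># edges G" for u
    using card_2_subset_of_edge(2)[OF assms(1) that] N by auto
  show ?thesis
    using N fin by (auto simp: neighbours_def interact_def new dest: old)
qed

lemma valid_initial_graph: "valid 0 initial_graph"
proof -
  have "{..<3::nat} = {0, 1, 2}" by auto
  then have "\<forall>v<3::nat. v \<in> {0, 1, 2}" by blast
  then show ?thesis by (simp add: valid_def initial_graph_def)
qed

section \<open>One step of the process\<close>

lemma expectation_bernoulli_bind:
  fixes h :: "'b \<Rightarrow> real"
  assumes "0 \<le> p" "p \<le> 1" "finite (set_pmf (F True))" "finite (set_pmf (F False))"
  shows "measure_pmf.expectation (bernoulli_pmf p \<bind> F) h =
    p * measure_pmf.expectation (F True) h + (1 - p) * measure_pmf.expectation (F False) h"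
proof -
  have "finite (set_pmf (F x))" for x using assms by (cases x) auto
  then show ?thesis using assms by (subst pmf_expectation_bind[of UNIV]) (auto simp: UNIV_bool)
qed

lemma expectation_bernoulli_choice:
  fixes f :: "'c \<Rightarrow> real"
  assumes "0 \<le> r" "r \<le> 1" "finite (set_pmf A)" "finite (set_pmf B)"
  shows "measure_pmf.expectation (bernoulli_pmf r \<bind> (\<lambda>b. (if b then A else B) \<bind> (\<lambda>x. return_pmf (g x)))) f =
    r * measure_pmf.expectation A (\<lambda>x. f (g x)) + (1 - r) * measure_pmf.expectation B (\<lambda>x. f (g x))"
  using assms by (subst expectation_bernoulli_bind) (auto simp flip: map_pmf_def)

lemma nverts_interact [simp]: "nverts (interact N t G) = N"
  by (simp add: interact_def)

context
  fixes n :: nat and G :: wgraph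
  assumes G: "valid n G"
begin

lemma nverts_ge_3: "3 \<le> nverts G"
  using G by (simp add: valid_def)

lemma uniform_subsets_nonempty: "k \<le> 3 \<Longrightarrow> subsets_of_card k {..<nverts G} \<noteq> {}"
  using nverts_ge_3 card_subsets_of_card[of "{..<nverts G}" k]
  by (metis card.empty card_lessThan finite_lessThan le_trans less_irrefl zero_less_binomial)

lemma triangles_nonempty: "triangles G \<noteq> {#}" and edges_nonempty: "edges G \<noteq> {#}"
proof -
  have "size (triangles G) > 0" "size (edges G) > 0" using G size_edges[OF G] by (simp_all add: valid_def)
  then show "triangles G \<noteq> {#}" "edges G \<noteq> {#}" using nonempty_has_size by blast+
qed

lemma finite_supports [simp]:
  "finite (set_pmf (pmf_of_multiset (edges G)))"
  "finite (set_pmf (pmf_of_multiset (triangles G)))"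
  "k \<le> 3 \<Longrightarrow> finite (set_pmf (pmf_of_set (subsets_of_card k {..<nverts G})))"
  using triangles_nonempty edges_nonempty uniform_subsets_nonempty by auto

lemma expectation_step:
  fixes f :: "wgraph \<Rightarrow> real"
  assumes "0 \<le> p" "p \<le> 1" "0 \<le> q" "q \<le> 1" "0 \<le> r" "r \<le> 1"
  shows "measure_pmf.expectation (step p q r G) f =
    p * (r * measure_pmf.expectation (pmf_of_multiset (edges G))
               (\<lambda>e. f (interact (Suc (nverts G)) (insert (nverts G) e) G)) +
         (1 - r) * measure_pmf.expectation (pmf_of_set (subsets_of_card 2 {..<nverts G}))
               (\<lambda>e. f (interact (Suc (nverts G)) (insert (nverts G) e) G))) +
    (1 - p) * (q * measure_pmf.expectation (pmf_of_multiset (triangles G))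
               (\<lambda>t. f (interact (nverts G) t G)) +
         (1 - q) * measure_pmf.expectation (pmf_of_set (subsets_of_card 3 {..<nverts G}))
               (\<lambda>t. f (interact (nverts G) t G)))"
  unfolding step_def using assms
  by (subst expectation_bernoulli_bind) (auto simp: expectation_bernoulli_choice split: if_splits)

lemma admissible_triangle: "t \<in># triangles G \<Longrightarrow> admissible G (nverts G) t"
  using G by (auto simp: admissible_def valid_def)

lemma admissible_uniform_triple:
  "t \<in> subsets_of_card 3 {..<nverts G} \<Longrightarrow> admissible G (nverts G) t"
  by (auto simp: admissible_def subsets_of_card_def)

lemma admissible_new_vertex:
  "e \<in> subsets_of_card 2 {..<nverts G} \<Longrightarrow> admissible G (Suc (nverts G)) (insert (nverts G) e)"
proof -
  assume e: "e \<in> subsets_of_card 2 {..<nverts G}"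
  then have "finite e" "nverts G \<notin> e" by (auto simp: subsets_of_card_def intro: finite_subset)
  with e show ?thesis by (auto simp: admissible_def subsets_of_card_def)
qed

lemma edge_in_pairs: "e \<in># edges G \<Longrightarrow> e \<in> subsets_of_card 2 {..<nverts G}"
  using card_2_subset_of_edge[OF G] by (auto simp: subsets_of_card_def)

lemma step_support:
  assumes "G' \<in> set_pmf (step p q r G)"
  obtains N t where "admissible G N t" "G' = interact N t G"
proof -
  have "(\<exists>e. e \<in> subsets_of_card 2 {..<nverts G} \<and> G' = interact (Suc (nverts G)) (insert (nverts G) e) G) \<or>
      (\<exists>t. (t \<in># triangles G \<or> t \<in> subsets_of_card 3 {..<nverts G}) \<and> G' = interact (nverts G) t G)"
    using assms triangles_nonempty edges_nonempty uniform_subsets_nonempty edge_in_pairs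
    unfolding step_def by (auto split: if_splits)
  then show ?thesis
    using that admissible_new_vertex admissible_triangle admissible_uniform_triple by blast
qed

lemma finite_step_support: "finite (set_pmf (step p q r G))"
  unfolding step_def by (auto split: if_splits)

end

section \<open>The change of a vertex class in one interaction\<close>

definition vertex_class :: "wgraph \<Rightarrow> nat \<Rightarrow> nat \<Rightarrow> nat set" where
  "vertex_class G d w = {v \<in> {..<nverts G}. degree G v = d \<and> vertex_weight G v = w}"

lemma num_vertices_eq: "num_vertices G d w = card (vertex_class G d w)"
  by (simp add: num_vertices_def vertex_class_def)

lemma finite_vertex_class [simp]: "finite (vertex_class G d w)"
  by (simp add: vertex_class_def)

text \<open>
  The weight is taken before the interaction of \<open>t\<close>, the degree after it.
\<close>

definition promoted :: "wgraph \<Rightarrow> nat set \<Rightarrow> nat \<Rightarrow> nat \<Rightarrow> nat set" where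
  "promoted G t d u = {v \<in> t. v < nverts G \<and> vertex_weight G v = u \<and> card (neighbours G v \<union> (t - {v})) = d}"

text \<open>
  The class of degree \<open>d\<close> and weight \<open>u + 1\<close> loses all its members in \<open>t\<close>, because their weight
  grows, and gains the promoted vertices together with the new vertex, which enters with degree \<open>2\<close> and
  weight \<open>1\<close>.
\<close>

lemma num_vertices_interact:
  assumes G: "valid n G" and t: "admissible G N t"
  shows "real (num_vertices (interact N t G) d (Suc u)) = real (num_vertices G d (Suc u))
    - real (card (t \<inter> vertex_class G d (Suc u))) + real (card (promoted G t d u))
    + of_bool (N \<noteq> nverts G \<and> d = 2 \<and> u = 0)"
proof -
  let ?V = "nverts G" and ?A = "vertex_class G d (Suc u)"
  let ?new = "if N \<noteq> ?V \<and> d = 2 \<and> u = 0 then {?V} else {}"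
  have fin: "finite t" using t card_3_finite by (auto simp: admissible_def)
  have finP: "finite (promoted G t d u)" using fin by (simp add: promoted_def)
  have old: "v \<in> vertex_class (interact N t G) d (Suc u) \<longleftrightarrow> v \<in> (?A - t) \<union> promoted G t d u"
    if "v < ?V" for v
    using that t
    by (auto simp: vertex_class_def promoted_def degree_eq neighbours_interact[OF G t]
        vertex_weight_interact admissible_def)
  have new: "?V \<in> vertex_class (interact N t G) d (Suc u) \<longleftrightarrow> ?V \<in> ?new"
  proof (cases "N = ?V")
    case True then show ?thesis by (simp add: vertex_class_def)
  next
    case False
    then have V: "?V \<in> t" "N = Suc ?V" "card t = 3" using t by (auto simp: admissible_def)
    have "filter_mset (\<lambda>s. ?V \<in> s) (triangles G) = {#}"
      by (rule trans[OF filter_mset_cong[OF refl, of _ _ "\<lambda>_. False"]]) (use G in \<open>auto simp: valid_def\<close>)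
    then have "vertex_weight G ?V = 0" by (simp add: vertex_weight_eq)
    moreover have "neighbours G ?V = {}"
      using card_2_subset_of_edge(2)[OF G] by (fastforce simp: neighbours_def)
    moreover have "card (t - {?V}) = 2" using V by simp
    ultimately have "degree (interact N t G) ?V = 2" "vertex_weight (interact N t G) ?V = 1"
      using V(1) by (auto simp: degree_eq neighbours_interact[OF G t] vertex_weight_interact)
    then show ?thesis using V(2) by (auto simp: vertex_class_def)
  qed
  have "vertex_class (interact N t G) d (Suc u) = ((?A - t) \<union> promoted G t d u) \<union> ?new"
  proof (rule set_eqI)
    fix v
    consider "v < ?V" | "v = ?V" | "v > ?V" by linarith
    then show "v \<in> vertex_class (interact N t G) d (Suc u) \<longleftrightarrow> v \<in> ((?A - t) \<union> promoted G t d u) \<union> ?new"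
    proof cases
      case 1 then show ?thesis using old by auto
    next
      case 2 then show ?thesis using new by (auto simp: vertex_class_def promoted_def)
    next
      case 3 then show ?thesis using t
        by (auto simp: vertex_class_def promoted_def admissible_def)
    qed
  qed
  also have "card \<dots> = card ((?A - t) \<union> promoted G t d u) + card ?new"
    using finP by (intro card_Un_disjoint) (auto simp: vertex_class_def promoted_def)
  also have "card ((?A - t) \<union> promoted G t d u) = card (?A - t) + card (promoted G t d u)"
    using finP by (intro card_Un_disjoint) (auto simp: promoted_def)
  finally have "num_vertices (interact N t G) d (Suc u) =
      card (?A - t) + card (promoted G t d u) + card ?new" by (simp add: num_vertices_eq)
  moreover have "card ?A = card (?A - t) + card (t \<inter> ?A)"
    using card_Diff_subset_Int[of ?A t] card_mono[of ?A "t \<inter> ?A"] fin by (simp add: Int_commute)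
  ultimately show ?thesis by (simp add: num_vertices_eq)
qed

lemma num_vertices_increment:
  assumes G: "valid n G" and t: "admissible G N t"
  shows "\<bar>real (num_vertices (interact N t G) d (Suc u)) - real (num_vertices G d (Suc u))\<bar> \<le> 4"
proof -
  have c: "card t = 3" "finite t" using t card_3_finite by (auto simp: admissible_def)
  have "card (t \<inter> vertex_class G d (Suc u)) \<le> 3" using c card_mono[of t "t \<inter> vertex_class G d (Suc u)"] by simp
  moreover have "card (promoted G t d u) \<le> 3" using c card_mono[of t "promoted G t d u"] by (auto simp: promoted_def)
  ultimately have "real (card (t \<inter> vertex_class G d (Suc u))) \<le> 3" "real (card (promoted G t d u)) \<le> 3"
    by simp_all
  moreover have "0 \<le> (of_bool (N \<noteq> nverts G \<and> d = 2 \<and> u = 0) :: real)"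
    "(of_bool (N \<noteq> nverts G \<and> d = 2 \<and> u = 0) :: real) \<le> 1" by simp_all
  ultimately show ?thesis unfolding num_vertices_interact[OF G t] by linarith
qed

text \<open>
  No edge is new when an old triangle interacts.
\<close>

lemma promoted_triangle:
  assumes "valid n G" "t \<in># triangles G"
  shows "promoted G t d u = t \<inter> vertex_class G d u"
proof -
  have "neighbours G v \<union> (t - {v}) = neighbours G v" if "v \<in> t" for v
    using triangle_minus_vertex_subset_neighbours[OF assms that] by blast
  then show ?thesis by (auto simp: promoted_def vertex_class_def degree_eq)
qed

text \<open>
  The endpoints of a chosen edge are neighbours already, so each gains only the new vertex.
\<close>

lemma promoted_edge:
  assumes G: "valid n G" and e: "e \<in># edges G" and d: "d \<ge> 1"
  shows "promoted G (insert (nverts G) e) d u = e \<inter> vertex_class G (d - 1) u"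
proof -
  have "card (neighbours G v \<union> (insert (nverts G) e - {v})) = Suc (degree G v)" if "v \<in> e" for v
  proof -
    have "v < nverts G" using card_2_subset_of_edge(2)[OF G e] that by auto
    obtain s where s: "s \<in># triangles G" "e \<subseteq> s" using edge_iff[OF G] e by blast
    have "e - {v} \<subseteq> neighbours G v"
      using triangle_minus_vertex_subset_neighbours[OF G s(1), of v] s(2) that by blast
    then have "neighbours G v \<union> (insert (nverts G) e - {v}) = insert (nverts G) (neighbours G v)"
      using \<open>v < nverts G\<close> by auto
    moreover have "nverts G \<notin> neighbours G v" by (simp add: neighbours_def)
    ultimately show ?thesis by (simp add: degree_eq)
  qed
  then show ?thesis using d by (auto simp: promoted_def vertex_class_def)
qed

text \<open>
  The exceptional vertices, whose degree may grow by less than two when \<open>t\<close> interacts.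
\<close>

definition clustered :: "wgraph \<Rightarrow> nat set \<Rightarrow> nat \<Rightarrow> nat set" where
  "clustered G t u = {v \<in> t. v < nverts G \<and> vertex_weight G v = u \<and> t \<inter> neighbours G v \<noteq> {}}"

text \<open>
  If no neighbour of \<open>v\<close> is in \<open>t\<close>, the two other elements of \<open>t\<close> become new neighbours of \<open>v\<close>.
\<close>

lemma promoted_generic:
  assumes t: "admissible G N t" and d: "d \<ge> 2"
  shows "\<bar>real (card (promoted G t d u)) - real (card (t \<inter> vertex_class G (d - 2) u))\<bar>
    \<le> real (card (clustered G t u))"
proof -
  let ?P = "promoted G t d u" and ?C = "t \<inter> vertex_class G (d - 2) u" and ?B = "clustered G t u"
  have c: "card t = 3" "finite t" using t card_3_finite by (auto simp: admissible_def)
  have deg: "card (neighbours G v \<union> (t - {v})) = degree G v + 2"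
    if "v \<in> t" "t \<inter> neighbours G v = {}" for v
  proof -
    have "card (neighbours G v \<union> (t - {v})) = card (neighbours G v) + card (t - {v})"
      using c that by (intro card_Un_disjoint) auto
    then show ?thesis using c that by (simp add: degree_eq)
  qed
  have "?P \<subseteq> ?C \<union> ?B" "?C \<subseteq> ?P \<union> ?B"
    using deg d by (auto simp: promoted_def clustered_def vertex_class_def)
  moreover have "finite ?P" "finite ?B" using c by (auto simp: promoted_def clustered_def)
  ultimately have "card ?P \<le> card ?C + card ?B" "card ?C \<le> card ?P + card ?B"
    using card_mono[of "?C \<union> ?B" ?P] card_Un_le[of ?C ?B] card_mono[of "?P \<union> ?B" ?C] card_Un_le[of ?P ?B] c
    by auto
  then show ?thesis by linarith
qed

section \<open>The expected change of a vertex class\<close>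

lemma expectation_cong_support:
  fixes f :: "'b \<Rightarrow> real"
  shows "(\<And>x. x \<in> set_pmf P \<Longrightarrow> f x = g x) \<Longrightarrow> measure_pmf.expectation P f = measure_pmf.expectation P g"
  by (rule integral_cong_AE) (auto simp: AE_measure_pmf_iff)

lemma expected_card_Int_const:
  assumes "finite A" "\<And>v. v \<in> A \<Longrightarrow> measure_pmf.prob T {t. v \<in> t} = c"
  shows "measure_pmf.expectation T (\<lambda>t. real (card (t \<inter> A))) = c * real (card A)"
  using assms by (simp add: expected_card_Int)

text \<open>
  The bookkeeping for \<open>drift_num_vertices\<close>: the brackets on the left are the expected sizes of a
  class of size \<open>a\<close> and weight \<open>w\<close> after an interaction of each of the four kinds, up to clustering.  The
  class gains vertices from the classes of sizes \<open>x0\<close>, \<open>x1\<close> and \<open>x2\<close>, whose weight is \<open>u\<close> and whose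
  degree is smaller by \<open>0\<close>, \<open>1\<close> and \<open>2\<close>.  The total triangle weight is \<open>N\<close>, the number of vertices \<open>W\<close>.
\<close>

lemma drift_identity:
  fixes p q r a new w u x0 x1 x2 N W :: real
  shows "p * (r * (a + new - 2 / 3 * w / N * a + 2 / 3 * u / N * x1)
        + (1 - r) * (a + new - 2 / W * a + 2 / W * x2))
      + (1 - p) * (q * (a - w / N * a + u / N * x0) + (1 - q) * (a - 3 / W * a + 3 / W * x2)) =
    a + (p * new + (1 - p) * q * (u * x0 - w * a) / N + 2 * p * r / 3 * (u * x1 - w * a) / N
      + (2 * p * (1 - r) + 3 * (1 - p) * (1 - q)) * (x2 - a) / W)"
proof -
  define i j where "i = 1 / N" and "j = 1 / W"
  have N: "y / N = y * i" and W: "y / W = y * j" for y by (simp_all add: i_def j_def)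
  show ?thesis unfolding N W by (simp add: field_simps)
qed

context
  fixes n :: nat and G :: wgraph
  assumes G: "valid n G"
begin

abbreviation (input) "class_size d w \<equiv> real (num_vertices G d w)"

lemma drift_triangle_by_weight:
  "measure_pmf.expectation (pmf_of_multiset (triangles G))
     (\<lambda>t. real (num_vertices (interact (nverts G) t G) d (Suc u))) =
   class_size d (Suc u) - real (Suc u) / real (Suc n) * class_size d (Suc u) + real u / real (Suc n) * class_size d u"
proof -
  let ?T = "pmf_of_multiset (triangles G)"
  note ne = triangles_nonempty[OF G]
  have int: "integrable (measure_pmf ?T) g" for g :: "nat set \<Rightarrow> real"
    by (rule integrable_measure_pmf_finite) (use ne in simp)
  have mean: "measure_pmf.expectation ?T (\<lambda>t. real (card (t \<inter> vertex_class G d w))) =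
      real w / real (Suc n) * class_size d w" for w
    unfolding num_vertices_eq
  proof (rule expected_card_Int_const)
    fix v assume "v \<in> vertex_class G d w"
    then show "measure_pmf.prob ?T {t. v \<in> t} = real w / real (Suc n)"
      using G by (subst prob_pmf_of_multiset[OF ne]) (auto simp: vertex_class_def vertex_weight_eq valid_def)
  qed simp
  have "measure_pmf.expectation ?T (\<lambda>t. real (num_vertices (interact (nverts G) t G) d (Suc u))) =
    measure_pmf.expectation ?T (\<lambda>t. class_size d (Suc u) - real (card (t \<inter> vertex_class G d (Suc u)))
      + real (card (t \<inter> vertex_class G d u)))"
    by (rule expectation_cong_support)
      (use ne in \<open>simp add: num_vertices_interact[OF G admissible_triangle[OF G]] promoted_triangle[OF G]\<close>)
  then show ?thesis by (simp add: int mean)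
qed

lemma drift_edge_by_weight:
  assumes d: "d \<ge> 1"
  shows "measure_pmf.expectation (pmf_of_multiset (edges G))
     (\<lambda>e. real (num_vertices (interact (Suc (nverts G)) (insert (nverts G) e) G) d (Suc u))) =
   class_size d (Suc u) + of_bool (d = 2 \<and> u = 0)
   - 2 / 3 * real (Suc u) / real (Suc n) * class_size d (Suc u) + 2 / 3 * real u / real (Suc n) * class_size (d - 1) u"
proof -
  let ?T = "pmf_of_multiset (edges G)" and ?V = "nverts G"
  note ne = edges_nonempty[OF G]
  have int: "integrable (measure_pmf ?T) g" for g :: "nat set \<Rightarrow> real"
    by (rule integrable_measure_pmf_finite) (use ne in simp)
  have mean: "measure_pmf.expectation ?T (\<lambda>t. real (card (t \<inter> vertex_class G c w))) =
      2 / 3 * real w / real (Suc n) * class_size c w" for c w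
    unfolding num_vertices_eq
  proof (rule expected_card_Int_const)
    fix v assume "v \<in> vertex_class G c w"
    then show "measure_pmf.prob ?T {t. v \<in> t} = 2 / 3 * real w / real (Suc n)"
      by (subst prob_pmf_of_multiset[OF ne])
        (simp add: vertex_class_def edge_weight_at_vertex[OF G] size_edges[OF G] field_simps)
  qed simp
  have "measure_pmf.expectation ?T (\<lambda>e. real (num_vertices (interact (Suc ?V) (insert ?V e) G) d (Suc u))) =
    measure_pmf.expectation ?T (\<lambda>e. class_size d (Suc u) + of_bool (d = 2 \<and> u = 0)
      - real (card (e \<inter> vertex_class G d (Suc u))) + real (card (e \<inter> vertex_class G (d - 1) u)))"
  proof (rule expectation_cong_support)
    fix e assume "e \<in> set_pmf ?T"
    then have e: "e \<in># edges G" using ne by simp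
    have "insert ?V e \<inter> vertex_class G d (Suc u) = e \<inter> vertex_class G d (Suc u)"
      by (auto simp: vertex_class_def)
    then show "real (num_vertices (interact (Suc ?V) (insert ?V e) G) d (Suc u)) =
       class_size d (Suc u) + of_bool (d = 2 \<and> u = 0)
       - real (card (e \<inter> vertex_class G d (Suc u))) + real (card (e \<inter> vertex_class G (d - 1) u))"
      using num_vertices_interact[OF G admissible_new_vertex[OF G edge_in_pairs[OF G e]], of d u]
        promoted_edge[OF G e d, of u] by simp
  qed
  then show ?thesis by (simp add: int mean)
qed

text \<open>
  A union bound over pairs of neighbours: each of the at most \<open>V\<close> vertices of weight \<open>u\<close> has at most
  \<open>2 * u\<close> neighbours, and a given pair lies in the random set with probability at most
  \<open>6 / (V * (V - 1))\<close>.
\<close>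

lemma expected_clustered:
  assumes "2 \<le> k" "k \<le> 3"
  shows "measure_pmf.expectation (pmf_of_set (subsets_of_card k {..<nverts G}))
      (\<lambda>t. real (card (clustered G t u))) \<le> 12 * real u / real (nverts G - 1)"
proof -
  let ?V = "nverts G" and ?T = "pmf_of_set (subsets_of_card k {..<nverts G})"
  let ?B = "{v \<in> {..<?V}. vertex_weight G v = u}"
  let ?b = "6 / (real ?V * real (?V - 1))"
  have ne: "subsets_of_card k {..<?V} \<noteq> {}" by (rule uniform_subsets_nonempty[OF G assms(2)])
  have int: "integrable (measure_pmf ?T) g" for g :: "nat set \<Rightarrow> real"
    by (rule integrable_measure_pmf_finite) (use ne in simp)
  have V: "?V \<ge> 3" by (rule nverts_ge_3[OF G])
  have pair: "measure_pmf.prob ?T {t. v \<in> t \<and> x \<in> t} \<le> ?b" if "v \<in> ?B" "x \<in> neighbours G v" for v x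
  proof -
    have "real k * real (k - 1) \<le> 3 * 2" using assms by (intro mult_mono) auto
    moreover have "measure_pmf.prob ?T {t. v \<in> t \<and> x \<in> t} = real k * real (k - 1) / (real ?V * real (?V - 1))"
      using prob_uniform_subset_contains_pair[of "{..<?V}" k v x] that assms V
      by (auto simp: neighbours_def)
    ultimately show ?thesis by (simp add: divide_right_mono)
  qed
  have "real (card (clustered G t u)) \<le>
      (\<Sum>v\<in>?B. \<Sum>x\<in>neighbours G v. indicator {t. v \<in> t \<and> x \<in> t} t)" for t
  proof -
    have "real (card (clustered G t u)) = (\<Sum>v\<in>?B. if v \<in> clustered G t u then 1 else 0)"
      by (subst sum.inter_filter[symmetric]) (auto simp: clustered_def intro!: arg_cong[where f = card])
    also have "\<dots> \<le> (\<Sum>v\<in>?B. \<Sum>x\<in>neighbours G v. indicator {t. v \<in> t \<and> x \<in> t} t)"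
    proof (rule sum_mono)
      fix v assume "v \<in> ?B"
      show "(if v \<in> clustered G t u then 1 else 0) \<le>
          (\<Sum>x\<in>neighbours G v. indicator {t. v \<in> t \<and> x \<in> t} t :: real)"
      proof (cases "v \<in> clustered G t u")
        case True
        then obtain x where "x \<in> t" "x \<in> neighbours G v" "v \<in> t" by (auto simp: clustered_def)
        then have "1 \<le> (\<Sum>x\<in>neighbours G v. indicator {t. v \<in> t \<and> x \<in> t} t :: real)"
          using member_le_sum[of x "neighbours G v" "\<lambda>x. indicator {t. v \<in> t \<and> x \<in> t} t :: real"]
          by simp
        then show ?thesis using True by simp
      qed (simp add: sum_nonneg)
    qed
    finally show ?thesis .
  qed
  then have "measure_pmf.expectation ?T (\<lambda>t. real (card (clustered G t u))) \<le>
      measure_pmf.expectation ?T (\<lambda>t. \<Sum>v\<in>?B. \<Sum>x\<in>neighbours G v. indicator {t. v \<in> t \<and> x \<in> t} t)"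
    by (intro integral_mono int) auto
  also have "\<dots> = (\<Sum>v\<in>?B. \<Sum>x\<in>neighbours G v. measure_pmf.prob ?T {t. v \<in> t \<and> x \<in> t})"
    by (simp add: int Bochner_Integration.integral_sum)
  also have "\<dots> \<le> (\<Sum>v\<in>?B. \<Sum>x\<in>neighbours G v. ?b)"
    by (intro sum_mono pair)
  also have "\<dots> = (\<Sum>v\<in>?B. real (degree G v) * ?b)" by (simp add: degree_eq)
  also have "\<dots> \<le> (\<Sum>v\<in>?B. 2 * real u * ?b)"
  proof (intro sum_mono mult_right_mono)
    fix v assume "v \<in> ?B"
    then show "real (degree G v) \<le> 2 * real u" using degree_le_twice_weight[OF G, of v] by simp
  qed simp
  also have "\<dots> = real (card ?B) * (2 * real u * ?b)" by (rule sum_constant)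
  also have "\<dots> \<le> real ?V * (2 * real u * ?b)"
  proof (rule mult_right_mono)
    have "card ?B \<le> card {..<?V}" by (rule card_mono) auto
    then show "real (card ?B) \<le> real ?V" by simp
  qed simp
  also have "\<dots> = 12 * real u / real (?V - 1)"
  proof -
    have "v * (2 * a * (6 / (v * w))) = 12 * a / w" if "v \<noteq> 0" for v a w :: real
      using that by simp
    from this[of "real ?V" "real u" "real (?V - 1)"] show ?thesis using V by simp
  qed
  finally show ?thesis .
qed

text \<open>
  The map \<open>g\<close> covers both uniform choices: it is the identity when three old vertices interact, and
  adds the new vertex to a pair of old ones otherwise.
\<close>

lemma drift_uniform:
  fixes g :: "nat set \<Rightarrow> nat set"
  assumes k: "2 \<le> k" "k \<le> 3" and d: "d \<ge> 2"
    and adm: "\<And>t. t \<in> subsets_of_card k {..<nverts G} \<Longrightarrow> admissible G N (g t)"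
    and g: "\<And>t. g t = t \<or> g t = insert (nverts G) t"
  shows "\<bar>measure_pmf.expectation (pmf_of_set (subsets_of_card k {..<nverts G}))
      (\<lambda>t. real (num_vertices (interact N (g t) G) d (Suc u))) -
     (class_size d (Suc u) + of_bool (N \<noteq> nverts G \<and> d = 2 \<and> u = 0)
      - real k / real (nverts G) * class_size d (Suc u) + real k / real (nverts G) * class_size (d - 2) u)\<bar>
    \<le> 12 * real u / real (nverts G - 1)"
proof -
  let ?V = "nverts G" and ?T = "pmf_of_set (subsets_of_card k {..<nverts G})"
  let ?new = "of_bool (N \<noteq> ?V \<and> d = 2 \<and> u = 0) :: real"
  have ne: "subsets_of_card k {..<?V} \<noteq> {}" by (rule uniform_subsets_nonempty[OF G k(2)])
  have int: "integrable (measure_pmf ?T) h" for h :: "nat set \<Rightarrow> real"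
    by (rule integrable_measure_pmf_finite) (use ne in simp)
  have V: "?V \<ge> 3" by (rule nverts_ge_3[OF G])
  have mean: "measure_pmf.expectation ?T (\<lambda>t. real (card (t \<inter> vertex_class G c w))) =
      real k / real ?V * class_size c w" for c w
    unfolding num_vertices_eq
  proof (rule expected_card_Int_const)
    fix v assume "v \<in> vertex_class G c w"
    then show "measure_pmf.prob ?T {t. v \<in> t} = real k / real ?V"
      using prob_uniform_subset_contains[of "{..<?V}" k v] k V by (simp add: vertex_class_def)
  qed simp
  let ?f = "\<lambda>t. real (num_vertices (interact N (g t) G) d (Suc u))"
  let ?m = "\<lambda>t. class_size d (Suc u) + ?new - real (card (t \<inter> vertex_class G d (Suc u)))
        + real (card (t \<inter> vertex_class G (d - 2) u))"
  have err: "\<bar>?f t - ?m t\<bar> \<le> real (card (clustered G t u))" if t: "t \<in> subsets_of_card k {..<?V}" for t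
  proof -
    have "g t \<inter> vertex_class G c w = t \<inter> vertex_class G c w" for c w
      using g[of t] by (auto simp: vertex_class_def)
    moreover have "clustered G (g t) u = clustered G t u"
      using g[of t] by (auto simp: clustered_def neighbours_def)
    ultimately show ?thesis
      using num_vertices_interact[OF G adm[OF t], of d u] promoted_generic[OF adm[OF t] d, of u] by simp
  qed
  have "\<bar>measure_pmf.expectation ?T ?f - measure_pmf.expectation ?T ?m\<bar> =
      \<bar>measure_pmf.expectation ?T (\<lambda>t. ?f t - ?m t)\<bar>"
    by (subst Bochner_Integration.integral_diff[OF int int]) simp
  also have "\<dots> \<le> measure_pmf.expectation ?T (\<lambda>t. \<bar>?f t - ?m t\<bar>)"
    by (rule integral_abs_bound)
  also have "\<dots> \<le> measure_pmf.expectation ?T (\<lambda>t. real (card (clustered G t u)))"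
    using err ne by (intro integral_mono_AE int) (auto simp: AE_measure_pmf_iff)
  also have "\<dots> \<le> 12 * real u / real (?V - 1)" by (rule expected_clustered[OF k])
  also have "measure_pmf.expectation ?T ?m = class_size d (Suc u) + ?new
      - real k / real ?V * class_size d (Suc u) + real k / real ?V * class_size (d - 2) u"
    by (simp add: int mean)
  finally show ?thesis .
qed

text \<open>
  The four ways to choose the interacting vertices, weighted by their probabilities.  The two
  uniform choices together have the coefficient \<open>2 * p * (1 - r) + 3 * (1 - p) * (1 - q)\<close>, which is
  \<open>p * beta p q r\<close>, and share the error bound.
\<close>

lemma drift_num_vertices:
  assumes p: "0 < p" "p \<le> 1" and q: "0 \<le> q" "q \<le> 1" and r: "0 \<le> r" "r \<le> 1" and d: "d \<ge> 2"
  shows "\<bar>measure_pmf.expectation (step p q r G) (\<lambda>G'. real (num_vertices G' d (Suc u))) - class_size d (Suc u) -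
     (p * of_bool (d = 2 \<and> u = 0)
      + alpha1 p q * (real u * class_size d u - real (Suc u) * class_size d (Suc u)) / real (Suc n)
      + alpha2 p r * (real u * class_size (d - 1) u - real (Suc u) * class_size d (Suc u)) / real (Suc n)
      + p * beta p q r * (class_size (d - 2) u - class_size d (Suc u)) / real (nverts G))\<bar>
    \<le> 12 * real u / real (nverts G - 1)"
proof -
  let ?V = "nverts G" and ?f = "\<lambda>G'. real (num_vertices G' d (Suc u))"
  let ?err = "12 * real u / real (?V - 1)"
  define E1 where "E1 = measure_pmf.expectation (pmf_of_multiset (edges G))
     (\<lambda>e. ?f (interact (Suc ?V) (insert ?V e) G))"
  define E2 where "E2 = measure_pmf.expectation (pmf_of_set (subsets_of_card 2 {..<?V}))
     (\<lambda>e. ?f (interact (Suc ?V) (insert ?V e) G))"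
  define E3 where "E3 = measure_pmf.expectation (pmf_of_multiset (triangles G))
     (\<lambda>t. ?f (interact ?V t G))"
  define E4 where "E4 = measure_pmf.expectation (pmf_of_set (subsets_of_card 3 {..<?V}))
     (\<lambda>t. ?f (interact ?V t G))"
  define new :: real where "new = of_bool (d = 2 \<and> u = 0)"
  define a where "a = class_size d (Suc u)"
  define N where "N = real (Suc n)"
  define W where "W = real ?V"
  have E1: "E1 = a + new - 2 / 3 * real (Suc u) / N * a + 2 / 3 * real u / N * class_size (d - 1) u"
    using drift_edge_by_weight[of d u] d by (simp add: E1_def a_def N_def new_def)
  have E3: "E3 = a - real (Suc u) / N * a + real u / N * class_size d u"
    using drift_triangle_by_weight[of d u] by (simp add: E3_def a_def N_def)
  define m2 where "m2 = a + new - 2 / W * a + 2 / W * class_size (d - 2) u"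
  define m4 where "m4 = a - 3 / W * a + 3 / W * class_size (d - 2) u"
  have E2: "\<bar>E2 - m2\<bar> \<le> ?err"
    using drift_uniform[of 2 d "Suc ?V" "insert ?V" u] d admissible_new_vertex[OF G]
    by (simp add: E2_def m2_def a_def new_def W_def)
  have E4: "\<bar>E4 - m4\<bar> \<le> ?err"
    using drift_uniform[of 3 d ?V "\<lambda>t. t" u] d admissible_uniform_triple[OF G]
    by (simp add: E4_def m4_def a_def W_def)
  have "measure_pmf.expectation (step p q r G) ?f = p * (r * E1 + (1 - r) * E2) + (1 - p) * (q * E3 + (1 - q) * E4)"
    unfolding E1_def E2_def E3_def E4_def using p q r by (intro expectation_step[OF G]) auto
  also have "\<dots> = p * (r * E1 + (1 - r) * m2) + (1 - p) * (q * E3 + (1 - q) * m4)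
      + (p * (1 - r) * (E2 - m2) + (1 - p) * (1 - q) * (E4 - m4))"
    by (simp add: algebra_simps)
  also have "p * (r * E1 + (1 - r) * m2) + (1 - p) * (q * E3 + (1 - q) * m4) = a +
     (p * new + alpha1 p q * (real u * class_size d u - real (Suc u) * a) / N
      + alpha2 p r * (real u * class_size (d - 1) u - real (Suc u) * a) / N
      + p * beta p q r * (class_size (d - 2) u - a) / W)"
  proof -
    have p_beta: "p * beta p q r = 2 * p * (1 - r) + 3 * (1 - p) * (1 - q)"
      using p by (simp add: beta_def field_simps)
    show ?thesis unfolding E1 E3 m2_def m4_def alpha1_def alpha2_def p_beta
      by (rule drift_identity)
  qed
  finally have "\<bar>measure_pmf.expectation (step p q r G) ?f - a -
     (p * new + alpha1 p q * (real u * class_size d u - real (Suc u) * a) / N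
      + alpha2 p r * (real u * class_size (d - 1) u - real (Suc u) * a) / N
      + p * beta p q r * (class_size (d - 2) u - a) / W)\<bar> =
     \<bar>p * (1 - r) * (E2 - m2) + (1 - p) * (1 - q) * (E4 - m4)\<bar>" by simp
  also have "\<dots> \<le> \<bar>p * (1 - r) * (E2 - m2)\<bar> + \<bar>(1 - p) * (1 - q) * (E4 - m4)\<bar>"
    by (rule abs_triangle_ineq)
  also have "\<dots> \<le> p * ?err + (1 - p) * ?err"
  proof (rule add_mono)
    have "p * (1 - r) * \<bar>E2 - m2\<bar> \<le> p * ?err"
      using E2 p r by (intro mult_mono mult_left_le) auto
    then show "\<bar>p * (1 - r) * (E2 - m2)\<bar> \<le> p * ?err" using p r by (simp add: abs_mult)
    have "(1 - p) * (1 - q) * \<bar>E4 - m4\<bar> \<le> (1 - p) * ?err"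
      using E4 p q by (intro mult_mono mult_left_le) auto
    then show "\<bar>(1 - p) * (1 - q) * (E4 - m4)\<bar> \<le> (1 - p) * ?err" using p q by (simp add: abs_mult)
  qed
  also have "\<dots> = ?err" unfolding distrib_right[symmetric] by simp
  finally show ?thesis by (simp add: a_def N_def W_def new_def)
qed

lemma drift_nverts:
  assumes "0 < p" "p \<le> 1" "0 \<le> q" "q \<le> 1" "0 \<le> r" "r \<le> 1"
  shows "measure_pmf.expectation (step p q r G) (\<lambda>G'. real (nverts G')) = real (nverts G) + p"
  using assms by (subst expectation_step[OF G]) (auto simp: algebra_simps)

end

section \<open>The limiting proportions and the almost sure convergence\<close>

primrec reachable :: "real \<Rightarrow> real \<Rightarrow> real \<Rightarrow> nat \<Rightarrow> wgraph set" where
  "reachable p q r 0 = {initial_graph}"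
| "reachable p q r (Suc n) = (\<Union>G\<in>reachable p q r n. set_pmf (step p q r G))"

lemma valid_reachable: "G \<in> reachable p q r n \<Longrightarrow> valid n G"
proof (induction n arbitrary: G)
  case 0 then show ?case by (simp add: valid_initial_graph)
next
  case (Suc n)
  then obtain H where H: "valid n H" "G \<in> set_pmf (step p q r H)" by auto
  then show ?case by (metis step_support valid_interact)
qed

lemma finite_reachable: "finite (reachable p q r n)"
  by (induction n) (auto intro: finite_step_support valid_reachable)

text \<open>
  The weight is the first argument, so that the recurrence of the theorem is primitive recursion in
  the weight with all degrees treated at once.  The summand for \<open>d = 2\<close> and \<open>u = 0\<close> accounts for the new
  vertices.
\<close>

primrec limit_ratio :: "real \<Rightarrow> real \<Rightarrow> real \<Rightarrow> nat \<Rightarrow> nat \<Rightarrow> real" where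
  "limit_ratio p q r 0 = (\<lambda>d. 0)"
| "limit_ratio p q r (Suc u) = (\<lambda>d.
     (of_bool (d = 2 \<and> u = 0) + alpha1 p q * real u * limit_ratio p q r u d
       + alpha2 p r * real u * limit_ratio p q r u (d - 1)
       + beta p q r * limit_ratio p q r u (d - 2)) /
     (alpha p q r * real (Suc u) + beta p q r + 1))"

text \<open>
  Truncated subtraction in the indices \<open>d - 1\<close> and \<open>d - 2\<close> is harmless, because it leads from indices
  below \<open>2\<close> to indices below \<open>2\<close>, where the values vanish.
\<close>

lemma limit_ratio_outside: "d < 2 \<or> 2 * w < d \<Longrightarrow> limit_ratio p q r w d = 0"
proof (induction w arbitrary: d)
  case (Suc u)
  have "limit_ratio p q r u d = 0" "limit_ratio p q r u (d - 1) = 0" "limit_ratio p q r u (d - 2) = 0"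
    using Suc.prems by (intro Suc.IH; arith)+
  then show ?case using Suc.prems by auto
qed simp

lemma parameters_nonneg:
  assumes "0 < p" "p \<le> 1" "0 \<le> q" "q \<le> 1" "0 \<le> r" "r \<le> 1"
  shows "0 \<le> alpha1 p q" "0 \<le> alpha2 p r" "0 \<le> alpha p q r" "0 \<le> beta p q r"
  using assms by (auto simp: alpha1_def alpha2_def alpha_def beta_def)

lemma limit_ratio_nonneg:
  assumes "0 < p" "p \<le> 1" "0 \<le> q" "q \<le> 1" "0 \<le> r" "r \<le> 1"
  shows "0 \<le> limit_ratio p q r w d"
proof (induction w arbitrary: d)
  case (Suc u)
  then show ?case using parameters_nonneg[OF assms] by (simp add: add_nonneg_nonneg)
qed simp

text \<open>
  For \<open>w \<ge> 2\<close> at least one summand of the recurrence is positive by induction: the first if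
  \<open>d \<le> 2 * w - 2\<close>, the second if \<open>d = 2 * w - 1\<close>, and the third if \<open>d = 2 * w\<close>.
\<close>

lemma limit_ratio_pos:
  assumes "0 < p" "p \<le> 1" "0 \<le> q" "q \<le> 1" "0 \<le> r" "r \<le> 1"
    and pos: "0 < alpha1 p q" "0 < alpha2 p r" "0 < beta p q r"
    and "1 \<le> w" "2 \<le> d" "d \<le> 2 * w"
  shows "0 < limit_ratio p q r w d"
  using assms(10-12)
proof (induction w arbitrary: d)
  case (Suc u)
  note nonneg = limit_ratio_nonneg[OF assms(1-6)]
  have den: "alpha p q r * real (Suc u) + beta p q r + 1 > 0"
    using parameters_nonneg[OF assms(1-6)] by (simp add: add_nonneg_pos)
  let ?a = "alpha1 p q * real u * limit_ratio p q r u d"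
  let ?b = "alpha2 p r * real u * limit_ratio p q r u (d - 1)"
  let ?c = "beta p q r * limit_ratio p q r u (d - 2)"
  have ge: "0 \<le> ?a" "0 \<le> ?b" "0 \<le> ?c" using pos nonneg by simp_all
  have "u = 0 \<or> u \<ge> 1 \<and> d \<le> 2 * u \<or> u \<ge> 1 \<and> d = 2 * u + 1 \<or> u \<ge> 1 \<and> d = 2 * u + 2"
    using Suc.prems by arith
  then consider "u = 0" | "u \<ge> 1" "d \<le> 2 * u" | "u \<ge> 1" "d = 2 * u + 1" | "u \<ge> 1" "d = 2 * u + 2"
    by blast
  then have "0 < of_bool (d = 2 \<and> u = 0) + ?a + ?b + ?c"
  proof cases
    case 1
    then show ?thesis using Suc.prems by simp
  next
    case 2
    then have "0 < ?a" using Suc pos by simp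
    then show ?thesis using ge by (simp add: add_pos_nonneg add_nonneg_pos)
  next
    case 3
    then have "0 < ?b" using Suc.IH[of "d - 1"] pos by simp
    then show ?thesis using ge by (simp add: add_pos_nonneg add_nonneg_pos)
  next
    case 4
    then have "0 < ?c" using Suc.IH[of "d - 2"] pos by simp
    then show ?thesis using ge by (simp add: add_pos_nonneg add_nonneg_pos)
  qed
  then show ?case using den by simp
qed simp

theorem theorem3p1:
  fixes M :: "'a measure" and p q r :: real and S :: "nat \<Rightarrow> 'a \<Rightarrow> wgraph"
  assumes "0 < p" "p \<le> 1" "0 \<le> q" "q \<le> 1" "0 \<le> r" "r \<le> 1"
    and "prob_space M"
    and "interaction_process M p q r S"
  shows "\<exists>x :: nat \<Rightarrow> nat \<Rightarrow> real.
    (\<forall>d w. \<not> (2 \<le> d \<and> d \<le> 2 * w) \<longrightarrow> x d w = 0) \<and>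
    x 2 1 = 1 / (alpha p q r + beta p q r + 1) \<and>
    (\<forall>d w. 2 \<le> w \<and> 2 \<le> d \<and> d \<le> 2 * w \<longrightarrow>
       x d w = 1 / (alpha p q r * real w + beta p q r + 1) *
         (alpha1 p q * real (w - 1) * x d (w - 1)
          + alpha2 p r * real (w - 1) * x (d - 1) (w - 1)
          + beta p q r * x (d - 2) (w - 1))) \<and>
    (\<forall>d w. 0 \<le> x d w) \<and>
    (\<forall>d w. 1 \<le> w \<and> 2 \<le> d \<and> d \<le> 2 * w \<longrightarrow>
       (0 < alpha1 p q \<and> 0 < alpha2 p r \<and> 0 < beta p q r \<longrightarrow> 0 < x d w) \<and>
       (AE \<omega> in M. (\<lambda>n. real (num_vertices (S n \<omega>) d w) / real (nverts (S n \<omega>)))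
                      \<longlonglongrightarrow> x d w))"
proof -
  note par = assms(1-6)
  interpret prob_space M by fact
  interpret finite_chain M S "step p q r" "reachable p q r"
  proof unfold_locales
    show "S n \<in> measurable M (count_space UNIV)" for n
      using assms(8) by (simp add: interaction_process_def)
    show "AE \<omega> in M. S 0 \<omega> \<in> reachable p q r 0"
      using assms(8) by (simp add: interaction_process_def)
    show "finite (reachable p q r n)" for n by (rule finite_reachable)
    show "set_pmf (step p q r G) \<subseteq> reachable p q r (Suc n)" if "G \<in> reachable p q r n" for G n
      using that by auto
    show "measure M {\<omega> \<in> space M. (\<forall>i\<le>n. S i \<omega> = h i) \<and> S (Suc n) \<omega> = s} =
        measure M {\<omega> \<in> space M. \<forall>i\<le>n. S i \<omega> = h i} * pmf (step p q r (h n)) s" for n h s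
      using assms(8) by (simp add: interaction_process_def)
  qed
  have AE_valid: "AE \<omega> in M. \<forall>n. valid n (S n \<omega>)"
    unfolding AE_all_countable
  proof
    show "AE \<omega> in M. valid n (S n \<omega>)" for n
      using AE_in_R[of n] by eventually_elim (rule valid_reachable)
  qed

  \<comment> \<open>The expected change of the number of vertices is exactly \<open>p\<close>.\<close>
  have AE_nverts: "AE \<omega> in M. (\<lambda>n. real (nverts (S n \<omega>)) / real (Suc n)) \<longlonglongrightarrow> p"
  proof -
    let ?f = "\<lambda>G. real (nverts G)"
    have "AE \<omega> in M. (\<lambda>n. (\<Sum>k<n. noise ?f k \<omega>) / real n) \<longlonglongrightarrow> 0"
    proof (rule noise_average_tendsto_0[where C = 1])
      fix n G G' assume "G \<in> reachable p q r n" "G' \<in> set_pmf (step p q r G)"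
      then obtain N t where "admissible G N t" "G' = interact N t G"
        using valid_reachable step_support by metis
      then show "\<bar>?f G' - ?f G\<bar> \<le> 1" by (auto simp: admissible_def)
    qed
    with AE_valid show ?thesis
    proof eventually_elim
      case (elim \<omega>)
      have "(\<lambda>n. ?f (S n \<omega>) / real (Suc n)) \<longlonglongrightarrow> p / (1 + 0)"
      proof (rule perturbed_recurrence_limit[where b = "\<lambda>_. p" and c = "\<lambda>_. 0"])
        fix n
        have "measure_pmf.expectation (step p q r (S n \<omega>)) ?f = ?f (S n \<omega>) + p"
          using elim(1) par by (intro drift_nverts) auto
        then show "?f (S (Suc n) \<omega>) = ?f (S n \<omega>) - 0 * ?f (S n \<omega>) / real (Suc n) + p + noise ?f n \<omega>"
          by (simp add: noise_def)
      qed (use elim in auto)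
      then show ?case by simp
    qed
  qed

  let ?x = "limit_ratio p q r"
  \<comment> \<open>The induction starts at weight \<open>0\<close>, where the class is empty, and runs over all degrees, including
    those below \<open>2\<close>, where the classes are empty as well.\<close>
  have AE_num_vertices: "AE \<omega> in M. (\<lambda>n. real (num_vertices (S n \<omega>) d w) / real (Suc n)) \<longlonglongrightarrow> p * ?x w d" for d w
  proof (induction w arbitrary: d)
    case 0
    show ?case using AE_valid
    proof eventually_elim
      case (elim \<omega>)
      have "num_vertices (S n \<omega>) d 0 = 0" for n
        using weight_pos[OF elim[rule_format, of n]] by (force simp: num_vertices_def)
      then show ?case by simp
    qed
  next
    case (Suc u)
    show ?case
    proof (cases "d \<ge> 2")
      case False
      show ?thesis using AE_valid
      proof eventually_elim
        case (elim \<omega>)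
        have "num_vertices (S n \<omega>) d (Suc u) = 0" for n
          using degree_ge_2[OF elim[rule_format, of n]] False by (force simp: num_vertices_def)
        moreover have "?x (Suc u) d = 0" using False by (intro limit_ratio_outside) simp
        ultimately show ?case by (simp del: limit_ratio.simps)
      qed
    next
      case d: True
      let ?f = "\<lambda>G. real (num_vertices G d (Suc u))"
      have "AE \<omega> in M. (\<lambda>n. (\<Sum>k<n. noise ?f k \<omega>) / real n) \<longlonglongrightarrow> 0"
      proof (rule noise_average_tendsto_0[where C = 4])
        fix n G G' assume "G \<in> reachable p q r n" "G' \<in> set_pmf (step p q r G)"
        then show "\<bar>?f G' - ?f G\<bar> \<le> 4"
          using valid_reachable step_support num_vertices_increment by metis
      qed
      with AE_valid AE_nverts Suc[of d] Suc[of "d - 1"] Suc[of "d - 2"] show ?thesis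
      proof eventually_elim
        case (elim \<omega>)
        let ?V = "\<lambda>n. real (nverts (S n \<omega>))" and ?N = "\<lambda>n. real (Suc n)"
        let ?X = "\<lambda>d w n. real (num_vertices (S n \<omega>) d w)"
        note V_lim = elim(2)
        have V3: "?V n \<ge> 3" for n using nverts_ge_3[OF elim(1)[rule_format, of n]] by simp
        \<comment> \<open>Needed to make the error of the drift vanish.\<close>
        have V_top: "filterlim ?V at_top at_top"
        proof -
          have "filterlim (\<lambda>n. ?V n / ?N n * ?N n) at_top at_top"
            by (rule filterlim_tendsto_pos_mult_at_top[OF V_lim par(1)
                filterlim_compose[OF filterlim_real_sequentially filterlim_Suc]])
          then show ?thesis by (simp del: of_nat_Suc)
        qed
        define drift where "drift n = p * of_bool (d = 2 \<and> u = 0)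
          + alpha1 p q * (real u * ?X d u n - real (Suc u) * ?X d (Suc u) n) / ?N n
          + alpha2 p r * (real u * ?X (d - 1) u n - real (Suc u) * ?X d (Suc u) n) / ?N n
          + p * beta p q r * (?X (d - 2) u n - ?X d (Suc u) n) / ?V n" for n
        define err where "err n =
          measure_pmf.expectation (step p q r (S n \<omega>)) ?f - ?X d (Suc u) n - drift n" for n
        have err_le: "\<bar>err n\<bar> \<le> 12 * real u / (?V n - 1)" for n
          using drift_num_vertices[OF elim(1)[rule_format, of n] par d, of u] V3[of n]
          by (simp add: err_def drift_def of_nat_diff)
        have err_lim: "err \<longlonglongrightarrow> 0"
        proof (rule Lim_null_comparison)
          show "\<forall>\<^sub>F n in sequentially. norm (err n) \<le> 12 * real u / (?V n - 1)"
            using err_le by simp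
          have "filterlim (\<lambda>n. -1 + ?V n) at_top at_top"
            by (rule filterlim_tendsto_add_at_top[OF tendsto_const V_top])
          then show "(\<lambda>n. 12 * real u / (?V n - 1)) \<longlonglongrightarrow> 0"
            by (intro tendsto_divide_0[OF tendsto_const] filterlim_at_top_imp_at_infinity) simp
        qed
        \<comment> \<open>The drift is split into the inflow \<open>b\<close>, which converges by the induction hypotheses, and the
          outflow, which is proportional to the size of the class.\<close>
        define b where "b n = p * of_bool (d = 2 \<and> u = 0)
          + alpha1 p q * real u * (?X d u n / ?N n) + alpha2 p r * real u * (?X (d - 1) u n / ?N n)
          + p * beta p q r * ((?X (d - 2) u n / ?N n) / (?V n / ?N n)) + err n" for n
        define c where "c n = alpha p q r * real (Suc u) + p * beta p q r / (?V n / ?N n)" for n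
        define num where "num = of_bool (d = 2 \<and> u = 0) + alpha1 p q * real u * ?x u d
          + alpha2 p r * real u * ?x u (d - 1) + beta p q r * ?x u (d - 2)"
        have p0: "p \<noteq> 0" using par by simp
        have "b \<longlonglongrightarrow> p * of_bool (d = 2 \<and> u = 0) + alpha1 p q * real u * (p * ?x u d)
          + alpha2 p r * real u * (p * ?x u (d - 1)) + p * beta p q r * ((p * ?x u (d - 2)) / p) + 0"
          unfolding b_def[abs_def] by (intro tendsto_intros elim V_lim err_lim p0)
        then have b_lim: "b \<longlonglongrightarrow> p * num" using p0 by (simp add: num_def algebra_simps)
        have "c \<longlonglongrightarrow> alpha p q r * real (Suc u) + p * beta p q r / p"
          unfolding c_def[abs_def] by (intro tendsto_intros V_lim p0)
        then have c_lim: "c \<longlonglongrightarrow> alpha p q r * real (Suc u) + beta p q r" using p0 by simp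
        have "(\<lambda>n. ?X d (Suc u) n / ?N n) \<longlonglongrightarrow> p * num / (1 + (alpha p q r * real (Suc u) + beta p q r))"
        proof (rule perturbed_recurrence_limit[OF _ b_lim c_lim])
          fix n
          have "?V n \<noteq> 0" using V3[of n] by linarith
          then have "drift n = b n - err n - c n * ?X d (Suc u) n / ?N n"
            by (simp add: drift_def b_def c_def alpha_def add_divide_distrib diff_divide_distrib
                algebra_simps del: of_nat_Suc)
          then show "?X d (Suc u) (Suc n) =
              ?X d (Suc u) n - c n * ?X d (Suc u) n / ?N n + b n + noise ?f n \<omega>"
            by (simp add: noise_def err_def)
          show "c n \<ge> 0" using parameters_nonneg[OF par] par by (simp add: c_def)
        qed (rule elim)
        moreover have "p * num / (1 + (alpha p q r * real (Suc u) + beta p q r)) = p * ?x (Suc u) d"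
          by (simp add: num_def add_ac)
        ultimately show ?case by simp
      qed
    qed
  qed

  have ratio: "AE \<omega> in M. (\<lambda>n. real (num_vertices (S n \<omega>) d w) / real (nverts (S n \<omega>))) \<longlonglongrightarrow> ?x w d" for d w
    using AE_nverts AE_num_vertices[of d w]
  proof eventually_elim
    case (elim \<omega>)
    then have "(\<lambda>n. (real (num_vertices (S n \<omega>) d w) / real (Suc n)) / (real (nverts (S n \<omega>)) / real (Suc n)))
        \<longlonglongrightarrow> p * ?x w d / p"
      using par by (intro tendsto_divide) auto
    then show ?case using par by (simp del: of_nat_Suc)
  qed

  show ?thesis
  proof (intro exI[of _ "\<lambda>d w. ?x w d"] conjI allI impI)
    fix d w
    show "?x w d = 0" if "\<not> (2 \<le> d \<and> d \<le> 2 * w)" using that by (intro limit_ratio_outside) auto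
    show "?x 1 2 = 1 / (alpha p q r + beta p q r + 1)" by simp
    show "0 \<le> ?x w d" by (rule limit_ratio_nonneg[OF par])
    show "?x w d = 1 / (alpha p q r * real w + beta p q r + 1) *
         (alpha1 p q * real (w - 1) * ?x (w - 1) d
          + alpha2 p r * real (w - 1) * ?x (w - 1) (d - 1)
          + beta p q r * ?x (w - 1) (d - 2))" if "2 \<le> w \<and> 2 \<le> d \<and> d \<le> 2 * w"
    proof -
      from that obtain u where u: "w = Suc u" "u \<noteq> 0" by (cases w) auto
      show ?thesis unfolding u(1) using u(2) by simp
    qed
    show "0 < ?x w d" if "1 \<le> w \<and> 2 \<le> d \<and> d \<le> 2 * w" "0 < alpha1 p q \<and> 0 < alpha2 p r \<and> 0 < beta p q r"
      using that by (intro limit_ratio_pos[OF par]) auto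
    show "AE \<omega> in M. (\<lambda>n. real (num_vertices (S n \<omega>) d w) / real (nverts (S n \<omega>))) \<longlonglongrightarrow> ?x w d"
      by (rule ratio)
  qed
qed

end
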